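(* Let $\Phi=\sum_{x\in\mathbb Z^d}\delta_{x+U}$ be the stationary lattice, where $U$ is uniformly distributed on the unit cube. Let $\{Z(x):x\in\mathbb Z^d\}$ be a stationary family of $\mathbb R^d$-valued random vectors, independent of $U$. Assume that $$\sum_{y\in\mathbb Z^d}\big\|\mathbb P((Z(y),Z(0))\in\cdot)-\mathbb P(Z(0)\in\cdot)^{\otimes2}\big\|<\infty .$$ Then $$\Gamma:=\sum_{x\in\mathbb Z^d}\delta_{x+U+Z(x)}$$ is a stationary point process and hyperuniform with respect to any Fourier smooth $W\in\mathcal K_0$.
   Context: For a finite signed measure $\nu$, $\|\nu\|:=\sup|\int f\,\mathrm d\nu|$ over measurable $f$ with values in $[-1,1]$. The unit cube is $[0,1]^d$. The family $\{Z(x):x\in\mathbb Z^d\}$ is stationary if $\{Z(x+z)\}_{x\in\mathbb Z^d}\overset{d}{=}\{Z(x)\}_{x\in\mathbb Z^d}$ for all $z\in\mathbb Z^d$. A point process on $\mathbb R^d$ is a random locally finite counting measure (multiplicities allowed); it is stationary if $\Gamma(\cdot+x)\overset{d}{=}\Gamma$ for all $x\in\mathbb R^d$. $\mathcal K_0$ is the set of convex bounded sets containing $0$ in their interior. With $\hat f(k)=\int f(x)e^{-i\langle k,x\rangle}\mathrm dx$, a bounded Borel set $B$ is Fourier smooth if there are $c,\vartheta>0$ with $|\widehat{\mathbf 1_B}(k)|\le c(1+\|k\|)^{-(d+\vartheta)/2}$ for all $k\in\mathbb R^d$. $\Gamma$ is hyperuniform w.r.t. $W$ if $\mathbb E\Gamma(B)^2<\infty$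 for all bounded Borel $B$ and $\lim_{r\to\infty}\lambda_d(rW)^{-1}\operatorname{Var}[\Gamma(rW)]=0$, where $\lambda_d$ is Lebesgue measure. *)

theory Defs
  imports "HOL-Probability.Probability"
begin

section \<open>The norm of a signed measure\<close>

text \<open>The norm \<open>\<parallel>\<mu> - \<nu>\<parallel>\<close> of the signed measure \<open>\<mu> - \<nu>\<close>, for finite measures \<open>\<mu>\<close> and \<open>\<nu>\<close> on the same
  measurable space; the integral against \<open>\<mu> - \<nu>\<close> is the difference of the integrals. For
  probability measures it takes values in \<open>[0,2]\<close>, so the supremum is a genuine one.\<close>

definition norm_diff :: "'b measure \<Rightarrow> 'b measure \<Rightarrow> real" where
  "norm_diff \<mu> \<nu> =
     (SUP f \<in> {f \<in> borel_measurable \<mu>. \<forall>x. f x \<in> {-1..1}}. \<bar>(\<integral>x. f x \<partial>\<mu>) - (\<integral>x. f x \<partial>\<nu>)\<bar>)"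


section \<open>Random fields on the integer lattice\<close>

text \<open>The index set is the type \<open>int ^ 'n\<close>; the following map embeds it into \<open>real ^ 'n\<close>.\<close>

definition lattice_pt :: "int ^ 'n \<Rightarrow> real ^ 'n" where
  "lattice_pt x = (\<chi> i. of_int (x $ i))"

definition stationary_field :: "'a measure \<Rightarrow> (int ^ 'n \<Rightarrow> 'a \<Rightarrow> real ^ 'n) \<Rightarrow> bool" where
  "stationary_field M Z \<longleftrightarrow>
     (\<forall>z. distr M (\<Pi>\<^sub>M x\<in>UNIV. borel) (\<lambda>\<omega> x. Z (x + z) \<omega>) = distr M (\<Pi>\<^sub>M x\<in>UNIV. borel) (\<lambda>\<omega> x. Z x \<omega>))"

text \<open>\<open>indep_var\<close> requires both variables to take values in the same type, so independence of
  random elements of different types is stated as independence of the generated sigma-algebras.\<close>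

definition indep_elements ::
  "'a measure \<Rightarrow> 'b measure \<Rightarrow> ('a \<Rightarrow> 'b) \<Rightarrow> 'c measure \<Rightarrow> ('a \<Rightarrow> 'c) \<Rightarrow> bool" where
  "indep_elements M N X K Y \<longleftrightarrow>
     X \<in> M \<rightarrow>\<^sub>M N \<and> Y \<in> M \<rightarrow>\<^sub>M K \<and>
     prob_space.indep_set M (sets (vimage_algebra (space M) X N)) (sets (vimage_algebra (space M) Y K))"


section \<open>Point processes\<close>

definition locally_finite_counting :: "(real ^ 'n) measure \<Rightarrow> bool" where
  "locally_finite_counting \<mu> \<longleftrightarrow>
     sets \<mu> = sets borel \<and> (\<forall>B \<in> sets borel. bounded B \<longrightarrow> emeasure \<mu> B \<in> range of_nat)"

text \<open>The measurable space of all Borel measures, with the sigma-algebra generated by the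
  evaluations \<open>\<mu> \<mapsto> \<mu> B\<close> (the construction of \<open>subprob_algebra\<close>, without a bound on the mass).\<close>

definition measure_space_algebra :: "(real ^ 'n) measure measure" where
  "measure_space_algebra =
     (SUP B \<in> sets borel. vimage_algebra {\<mu>. sets \<mu> = sets borel} (\<lambda>\<mu>. emeasure \<mu> B) borel)"

text \<open>As usual, local finiteness is required almost surely: a sum of Dirac measures at infinitely
  many random points may fail to be locally finite on a null set.\<close>

definition point_process :: "'a measure \<Rightarrow> ('a \<Rightarrow> (real ^ 'n) measure) \<Rightarrow> bool" where
  "point_process M \<Gamma> \<longleftrightarrow>
     \<Gamma> \<in> M \<rightarrow>\<^sub>M measure_space_algebra \<and> (AE \<omega> in M. locally_finite_counting (\<Gamma> \<omega>))"

text \<open>\<open>B \<mapsto> \<mu> (B + x)\<close> is the image of \<open>\<mu>\<close> under \<open>y \<mapsto> y - x\<close>.\<close>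

definition shift_measure :: "real ^ 'n \<Rightarrow> (real ^ 'n) measure \<Rightarrow> (real ^ 'n) measure" where
  "shift_measure x \<mu> = distr \<mu> borel (\<lambda>y. y - x)"

definition stationary_point_process :: "'a measure \<Rightarrow> ('a \<Rightarrow> (real ^ 'n) measure) \<Rightarrow> bool" where
  "stationary_point_process M \<Gamma> \<longleftrightarrow>
     point_process M \<Gamma> \<and>
     (\<forall>x. distr M measure_space_algebra (\<lambda>\<omega>. shift_measure x (\<Gamma> \<omega>))
          = distr M measure_space_algebra \<Gamma>)"

text \<open>The sum of the Dirac measures at the points \<open>p x\<close>, counted with multiplicity, is the image of
  the counting measure on the index set.\<close>

definition dirac_sum :: "('i \<Rightarrow> real ^ 'n) \<Rightarrow> (real ^ 'n) measure" where
  "dirac_sum p = distr (count_space UNIV) borel p"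

lemma emeasure_dirac_sum:
  assumes "B \<in> sets borel"
  shows "emeasure (dirac_sum p) B = (\<integral>\<^sup>+x. emeasure (return borel (p x)) B \<partial>count_space UNIV)"
proof -
  have "(\<integral>\<^sup>+x. emeasure (return borel (p x)) B \<partial>count_space UNIV)
      = (\<integral>\<^sup>+x. indicator (p -` B) x \<partial>count_space UNIV)"
    using assms by (simp add: indicator_vimage)
  then show ?thesis
    using assms by (simp add: dirac_sum_def emeasure_distr)
qed


section \<open>Fourier smoothness and hyperuniformity\<close>

definition K0 :: "(real ^ 'n) set set" where
  "K0 = {W. convex W \<and> bounded W \<and> 0 \<in> interior W}"

definition fourier :: "(real ^ 'n \<Rightarrow> complex) \<Rightarrow> real ^ 'n \<Rightarrow> complex" where
  "fourier f k = (\<integral>x. f x * exp (- \<i> * complex_of_real (k \<bullet> x)) \<partial>lborel)"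

definition fourier_smooth :: "(real ^ 'n) set \<Rightarrow> bool" where
  "fourier_smooth B \<longleftrightarrow>
     bounded B \<and> B \<in> sets borel \<and>
     (\<exists>c > 0. \<exists>\<theta> > 0. \<forall>k. norm (fourier (indicator B) k)
        \<le> c * (1 + norm k) powr (- (real CARD('n) + \<theta>) / 2))"

text \<open>The second moments are extended nonnegative integrals, so the first conjunct forces
  \<open>\<Gamma> B < \<infinity>\<close> almost surely; only then does \<open>measure (\<Gamma> \<omega>) B\<close> represent the number of points.\<close>

definition hyperuniform ::
  "'a measure \<Rightarrow> ('a \<Rightarrow> (real ^ 'n) measure) \<Rightarrow> (real ^ 'n) set \<Rightarrow> bool" where
  "hyperuniform M \<Gamma> W \<longleftrightarrow>
     (\<forall>B \<in> sets borel. bounded B \<longrightarrow> (\<integral>\<^sup>+\<omega>. (emeasure (\<Gamma> \<omega>) B)\<^sup>2 \<partial>M) < \<infinity>) \<and>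
     ((\<lambda>r. prob_space.variance M (\<lambda>\<omega>. measure (\<Gamma> \<omega>) ((\<lambda>x. r *\<^sub>R x) ` W))
            / measure lborel ((\<lambda>x. r *\<^sub>R x) ` W)) \<longlongrightarrow> 0) at_top"

end

theory Submission
  imports Defs
begin

text \<open>
  Write \<open>overlap B t\<close> for the volume of \<open>B \<inter> (B - t)\<close>. The uniform shift \<open>U\<close> turns sums over the
  lattice into Lebesgue integrals; this yields stationarity and
  \<open>E \<Gamma>(B)\<^sup>2 = (\<Sum>y. E overlap B (y + Z y - Z 0))\<close>. If \<open>(Z y, Z 0)\<close> is replaced by an independent pair,
  each summand changes by at most \<open>\<lambda>(B)\<close> times the mixing coefficient at \<open>y\<close>; for \<open>B = r W\<close> the change
  divided by \<open>\<lambda>(r W)\<close> tends to \<open>0\<close> for every \<open>y\<close>, since \<open>overlap (r W) t / \<lambda>(r W) \<rightarrow> 1\<close>, so dominated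
  convergence applies to the sum over \<open>y\<close>. What remains is \<open>\<Sum>y. overlap B (y + t)\<close>, which for every
  \<open>t\<close> is at most the sum of the squared Fourier coefficients of \<open>B\<close> on the dual lattice (test against
  the Fejer kernel and use that \<open>overlap B\<close> is continuous for convex \<open>B\<close>). The zero frequency
  contributes \<open>\<lambda>(B)\<^sup>2\<close>, and Fourier smoothness makes the others \<open>O(r\<^bsup>d - \<theta>\<^esup>)\<close>.
\<close>

section \<open>Integration over the unit tile\<close>

text \<open>Passing to an independent pair is what makes the lattice sum accessible. In
  \<open>overlap B (y + Z y - Z 0)\<close> the law of the shift changes with \<open>y\<close>, so
  periodicity cannot be exploited. For an independent pair one law of the shift serves all
  \<open>y\<close>, and the sum can be bounded for each value of the shift separately, provided the
  bound is uniform in that value. Poisson summation would express the sum exactly, with phases, but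
  raises the question of pointwise convergence. Only an upper bound is wanted, since a variance is
  nonnegative anyway. A nonnegative kernel with Fourier coefficients in [0,1] supplies it: the
  phases vanish in absolute values, and the mass of the kernel away from the lattice is dropped.
  Point values of the overlap are then recovered from averages near lattice points, which is where
  continuity, hence convexity, enters. The process has intensity one, so the zero frequency is
  exactly the squared mean. The leading order r^(2d) therefore cancels in the variance, leaving
  O(r^(d - \<theta>)) plus the o(r^d) cost of the comparison.\<close>

definition unit_tile :: "(real ^ 'n) set" where
  "unit_tile = {x. \<forall>i. 0 \<le> x $ i \<and> x $ i < 1}"

lemma sets_unit_tile [measurable]: "unit_tile \<in> sets borel"
  unfolding unit_tile_def by measurable

text \<open>The tile is half-open, so its integer translates partition space exactly and the floor
  selects the one containing \<open>x\<close>. The closed cube carrying the law of \<open>U\<close>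
  differs from it only by a null set.\<close>

lemma unit_tile_translate_iff:
  "x - lattice_pt w \<in> unit_tile \<longleftrightarrow> w = (\<chi> i. \<lfloor>x $ i\<rfloor>)"
  by (auto simp: unit_tile_def lattice_pt_def vec_eq_iff eq_commute[of _ "\<lfloor>_\<rfloor>"] floor_eq_iff algebra_simps)

lemma nn_integral_translate_lborel:
  fixes f :: "'b::euclidean_space \<Rightarrow> ennreal"
  assumes "f \<in> borel_measurable borel"
  shows "(\<integral>\<^sup>+x. f (c + x) \<partial>lborel) = (\<integral>\<^sup>+x. f x \<partial>lborel)"
  using assms by (subst (2) lborel_distr_plus[symmetric, of c]) (simp add: nn_integral_distr)

text \<open>The constant 1 is decomposed over the lattice translates of the tile. Inserting it
  unfolds a Lebesgue integral into the tile; read backwards, it localises an expectation to the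
  tile.\<close>

lemma nn_integral_count_space_unit_tile:
  "(\<integral>\<^sup>+w. c * indicator unit_tile (x - lattice_pt w) \<partial>count_space UNIV) = c"
proof -
  have "(\<integral>\<^sup>+w. c * indicator unit_tile (x - lattice_pt w) \<partial>count_space UNIV)
      = (\<integral>\<^sup>+w. c * indicator {\<chi> i. \<lfloor>x $ i\<rfloor>} w \<partial>count_space UNIV)"
    by (intro nn_integral_cong) (simp add: unit_tile_translate_iff indicator_def)
  then show ?thesis
    by (simp add: nn_integral_cmult)
qed

lemma nn_integral_lborel_tiling:
  fixes f :: "real ^ 'n \<Rightarrow> ennreal"
  assumes [measurable]: "f \<in> borel_measurable borel"
  shows "(\<integral>\<^sup>+x. f x \<partial>lborel)
    = (\<integral>\<^sup>+w. (\<integral>\<^sup>+v. f (lattice_pt w + v) * indicator unit_tile v \<partial>lborel) \<partial>count_space UNIV)"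
proof -
  have "(\<integral>\<^sup>+x. f x \<partial>lborel)
      = (\<integral>\<^sup>+x. (\<integral>\<^sup>+w. f x * indicator unit_tile (x - lattice_pt w) \<partial>count_space UNIV) \<partial>lborel)"
    by (simp add: nn_integral_count_space_unit_tile)
  also have "\<dots> = (\<integral>\<^sup>+w. (\<integral>\<^sup>+x. f x * indicator unit_tile (x - lattice_pt w) \<partial>lborel) \<partial>count_space UNIV)"
    by (intro nn_integral_count_space_nn_integral) auto
  also have "\<dots> = (\<integral>\<^sup>+w. (\<integral>\<^sup>+v. f (lattice_pt w + v) * indicator unit_tile v \<partial>lborel) \<partial>count_space UNIV)"
  proof (rule nn_integral_cong)
    fix w :: "int ^ 'n"
    show "(\<integral>\<^sup>+x. f x * indicator unit_tile (x - lattice_pt w) \<partial>lborel)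
        = (\<integral>\<^sup>+v. f (lattice_pt w + v) * indicator unit_tile v \<partial>lborel)"
      by (subst nn_integral_translate_lborel[symmetric, where c = "lattice_pt w"]) simp_all
  qed
  finally show ?thesis .
qed

lemma AE_unit_tile_iff_cbox:
  "AE x in lborel. x \<in> cbox 0 1 \<longleftrightarrow> x \<in> (unit_tile :: (real ^ 'n) set)"
proof -
  have "negligible (cbox 0 (1 :: real ^ 'n) - box 0 1)"
    by (simp add: negligible_frontier_interval)
  then have "cbox 0 (1 :: real ^ 'n) - box 0 1 \<in> null_sets lborel"
    by (simp add: negligible_iff_null_sets null_sets_completion_iff)
  then have "AE x in lborel. x \<notin> cbox 0 (1 :: real ^ 'n) - box 0 1"
    by (rule AE_not_in)
  then show ?thesis
    by eventually_elim (auto simp: unit_tile_def mem_box_cart less_imp_le)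
qed

lemma nn_integral_uniform_cbox:
  fixes f :: "real ^ 'n \<Rightarrow> ennreal"
  assumes [measurable]: "f \<in> borel_measurable borel"
  shows "(\<integral>\<^sup>+x. f x \<partial>uniform_measure lborel (cbox 0 1)) = (\<integral>\<^sup>+x. f x * indicator unit_tile x \<partial>lborel)"
proof -
  have "emeasure lborel (cbox 0 (1 :: real ^ 'n)) = 1"
    unfolding emeasure_lborel_cbox_eq by (subst prod.neutral) (auto simp: Basis_vec_def inner_axis)
  then have "(\<integral>\<^sup>+x. f x \<partial>uniform_measure lborel (cbox 0 1)) = (\<integral>\<^sup>+x. f x * indicator (cbox 0 1) x \<partial>lborel)"
    by (simp add: nn_integral_uniform_measure divide_ennreal_def)
  also have "\<dots> = (\<integral>\<^sup>+x. f x * indicator unit_tile x \<partial>lborel)"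
    using AE_unit_tile_iff_cbox by (intro nn_integral_cong_AE) (auto simp: indicator_def)
  finally show ?thesis .
qed

section \<open>Random sums of Dirac measures\<close>

lemma space_PiM_borel_UNIV [simp]: "space (\<Pi>\<^sub>M x\<in>UNIV. borel) = UNIV"
  by (simp add: space_PiM)

lemma measurable_measure_space_algebraI:
  assumes "\<And>x. x \<in> space N \<Longrightarrow> sets (f x) = sets borel"
    and "\<And>B. B \<in> sets borel \<Longrightarrow> (\<lambda>x. emeasure (f x) B) \<in> borel_measurable N"
  shows "f \<in> N \<rightarrow>\<^sub>M measure_space_algebra"
  unfolding measure_space_algebra_def
  using assms by (intro measurable_SUP2 measurable_vimage_algebra2) auto

lemma measurable_emeasure_measure_space_algebra:
  fixes B :: "(real ^ 'n) set"
  assumes "B \<in> sets borel"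
  shows "(\<lambda>\<mu>. emeasure \<mu> B) \<in> borel_measurable (measure_space_algebra :: (real ^ 'n) measure measure)"
  unfolding measure_space_algebra_def
  using assms by (intro measurable_SUP1[of B] measurable_vimage_algebra1) auto

lemma sets_dirac_sum [simp]: "sets (dirac_sum p) = sets borel"
  by (simp add: dirac_sum_def)

lemma emeasure_dirac_sum_indicator:
  assumes "B \<in> sets borel"
  shows "emeasure (dirac_sum p) B = (\<integral>\<^sup>+x. indicator B (p x) \<partial>count_space UNIV)"
  using assms by (simp add: emeasure_dirac_sum)

text \<open>Countability of the index type makes the summand jointly measurable in \<open>z\<close>
  and \<open>i\<close>, so each count is a measurable integral over the counting measure.\<close>

lemma measurable_dirac_sum:
  fixes p :: "'i::countable \<Rightarrow> 'b \<Rightarrow> real ^ 'n"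
  assumes "\<And>i. p i \<in> borel_measurable N"
  shows "(\<lambda>z. dirac_sum (\<lambda>i. p i z)) \<in> N \<rightarrow>\<^sub>M measure_space_algebra"
proof (rule measurable_measure_space_algebraI)
  fix B :: "(real ^ 'n) set" assume [measurable]: "B \<in> sets borel"
  interpret sigma_finite_measure "count_space (UNIV :: 'i set)"
    by (rule sigma_finite_measure_count_space)
  note [measurable] = assms
  have "(\<lambda>(z, i). indicator B (p i z) :: ennreal) \<in> borel_measurable (N \<Otimes>\<^sub>M count_space UNIV)"
    by measurable
  then show "(\<lambda>z. emeasure (dirac_sum (\<lambda>i. p i z)) B) \<in> borel_measurable N"
    by (simp add: emeasure_dirac_sum_indicator borel_measurable_nn_integral)
qed simp

text \<open>A sum of Dirac measures forgets the labels of its points; lattice shifts of the index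
  are absorbed this way.\<close>

lemma dirac_sum_reindex:
  assumes "bij \<pi>"
  shows "dirac_sum (\<lambda>i. p (\<pi> i)) = dirac_sum p"
proof -
  have "dirac_sum (\<lambda>i. p (\<pi> i)) = distr (distr (count_space UNIV) (count_space UNIV) \<pi>) borel p"
    by (simp add: dirac_sum_def distr_distr o_def)
  also have "distr (count_space UNIV) (count_space UNIV) \<pi> = count_space UNIV"
    using assms by (rule distr_bij_count_space)
  finally show ?thesis
    by (simp add: dirac_sum_def)
qed

lemma shift_dirac_sum: "shift_measure x (dirac_sum p) = dirac_sum (\<lambda>i. p i - x)"
  by (simp add: shift_measure_def dirac_sum_def distr_distr o_def)

lemma lattice_pt_add: "lattice_pt (x + y) = lattice_pt x + lattice_pt y"
  by (simp add: lattice_pt_def vec_eq_iff)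

lemma lattice_pt_minus: "lattice_pt (- x) = - lattice_pt x"
  by (simp add: lattice_pt_def vec_eq_iff)

text \<open>Independence of the generated sigma-algebras gives agreement on measurable rectangles,
  and these determine a product of sigma-finite measures.\<close>

lemma (in prob_space) distr_pair_indep_elements:
  assumes "indep_elements M N X K Y"
  shows "distr M (N \<Otimes>\<^sub>M K) (\<lambda>\<omega>. (X \<omega>, Y \<omega>)) = distr M N X \<Otimes>\<^sub>M distr M K Y"
proof -
  have [measurable]: "X \<in> M \<rightarrow>\<^sub>M N" "Y \<in> M \<rightarrow>\<^sub>M K"
    and ind: "indep_set (sets (vimage_algebra (space M) X N)) (sets (vimage_algebra (space M) Y K))"
    using assms by (auto simp: indep_elements_def)
  interpret X: prob_space "distr M N X" by (rule prob_space_distr) measurable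
  interpret Y: prob_space "distr M K Y" by (rule prob_space_distr) measurable
  show ?thesis
  proof (rule pair_measure_eqI[symmetric])
    fix A B assume "A \<in> sets (distr M N X)" "B \<in> sets (distr M K Y)"
    then have [measurable]: "A \<in> sets N" "B \<in> sets K" by auto
    have "prob ((X -` A \<inter> space M) \<inter> (Y -` B \<inter> space M)) = prob (X -` A \<inter> space M) * prob (Y -` B \<inter> space M)"
      by (intro indep_setD[OF ind] in_vimage_algebra) auto
    moreover have "(\<lambda>\<omega>. (X \<omega>, Y \<omega>)) -` (A \<times> B) \<inter> space M = (X -` A \<inter> space M) \<inter> (Y -` B \<inter> space M)"
      by auto
    ultimately show "emeasure (distr M N X) A * emeasure (distr M K Y) B
        = emeasure (distr M (N \<Otimes>\<^sub>M K) (\<lambda>\<omega>. (X \<omega>, Y \<omega>))) (A \<times> B)"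
      by (simp add: emeasure_distr emeasure_eq_measure ennreal_mult')
  qed (auto intro: X.sigma_finite_measure_axioms Y.sigma_finite_measure_axioms)
qed

section \<open>The perturbed lattice and its second moment\<close>

text \<open>This is the covariogram of \<open>B\<close>, the autocorrelation of its indicator; hence
  its Fourier transform will be a squared modulus.\<close>

definition overlap :: "'b::euclidean_space set \<Rightarrow> 'b \<Rightarrow> real" where
  "overlap B t = measure lborel (B \<inter> (\<lambda>v. v + t) -` B)"

lemma ennreal_overlap:
  fixes B :: "'b::euclidean_space set"
  assumes [measurable]: "B \<in> sets borel" and "bounded B"
  shows "ennreal (overlap B t) = (\<integral>\<^sup>+v. indicator B v * indicator B (v + t) \<partial>lborel)"
proof -
  have [measurable]: "(\<lambda>v. v + t) -` B \<in> sets borel"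
    using measurable_sets[of "\<lambda>v. v + t" borel borel B] by simp
  have "emeasure lborel (B \<inter> (\<lambda>v. v + t) -` B) \<le> emeasure lborel B"
    by (intro emeasure_mono) auto
  also have "\<dots> < \<infinity>"
    using \<open>bounded B\<close> by (rule emeasure_bounded_finite)
  finally have "ennreal (overlap B t) = emeasure lborel (B \<inter> (\<lambda>v. v + t) -` B)"
    by (simp add: overlap_def emeasure_eq_ennreal_measure)
  also have "\<dots> = (\<integral>\<^sup>+v. indicator (B \<inter> (\<lambda>v. v + t) -` B) v \<partial>lborel)"
    by simp
  also have "\<dots> = (\<integral>\<^sup>+v. indicator B v * indicator B (v + t) \<partial>lborel)"
    by (intro nn_integral_cong) (simp add: indicator_def)
  finally show ?thesis .
qed

locale perturbed_lattice = prob_space M for M :: "'a measure" +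
  fixes U :: "'a \<Rightarrow> real ^ 'n" and Z :: "int ^ 'n \<Rightarrow> 'a \<Rightarrow> real ^ 'n"
  assumes U_measurable [measurable]: "U \<in> borel_measurable M"
    and U_uniform: "distr M borel U = uniform_measure lborel (cbox 0 1)"
    and Z_measurable [measurable]: "\<And>x. Z x \<in> borel_measurable M"
    and Z_stationary: "stationary_field M Z"
    and U_Z_indep: "indep_elements M borel U (\<Pi>\<^sub>M x\<in>UNIV. borel) (\<lambda>\<omega> x. Z x \<omega>)"
begin

text \<open>The whole field is bundled into one random element of the product space, so that
  stationarity and independence of \<open>U\<close> become statements about its law.\<close>

definition displacement :: "'a \<Rightarrow> int ^ 'n \<Rightarrow> real ^ 'n" where
  "displacement \<omega> = (\<lambda>x. Z x \<omega>)"

definition lattice_process :: "'a \<Rightarrow> (real ^ 'n) measure" where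
  "lattice_process \<omega> = dirac_sum (\<lambda>x. lattice_pt x + U \<omega> + Z x \<omega>)"

abbreviation config_space :: "(int ^ 'n \<Rightarrow> real ^ 'n) measure" where
  "config_space \<equiv> \<Pi>\<^sub>M x\<in>UNIV. borel"

lemma displacement_measurable [measurable]: "displacement \<in> M \<rightarrow>\<^sub>M config_space"
  unfolding displacement_def by (rule measurable_PiM_single') (auto simp: space_PiM)

lemma shift_config_measurable [measurable]:
  "(\<lambda>z x. z (x + w)) \<in> config_space \<rightarrow>\<^sub>M config_space"
  by (rule measurable_PiM_single') (auto simp: space_PiM)

section \<open>Campbell's formula for the lattice with its displacement field\<close>

lemma nn_integral_shift_displacement:
  assumes [measurable]: "F \<in> borel_measurable config_space"
  shows "(\<integral>\<^sup>+\<omega>. F (\<lambda>x. displacement \<omega> (x + w)) \<partial>M) = (\<integral>\<^sup>+\<omega>. F (displacement \<omega>) \<partial>M)"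
proof -
  have [measurable]: "(\<lambda>\<omega> x. displacement \<omega> (x + w)) \<in> M \<rightarrow>\<^sub>M config_space"
    using measurable_comp[OF displacement_measurable shift_config_measurable] by (simp add: o_def)
  have "(\<integral>\<^sup>+\<omega>. F (\<lambda>x. displacement \<omega> (x + w)) \<partial>M) = (\<integral>\<^sup>+z. F z \<partial>distr M config_space (\<lambda>\<omega> x. displacement \<omega> (x + w)))"
    by (simp add: nn_integral_distr)
  also have "distr M config_space (\<lambda>\<omega> x. displacement \<omega> (x + w)) = distr M config_space displacement"
    using Z_stationary unfolding stationary_field_def displacement_def by blast
  also have "(\<integral>\<^sup>+z. F z \<partial>distr M config_space displacement) = (\<integral>\<^sup>+\<omega>. F (displacement \<omega>) \<partial>M)"
    by (simp add: nn_integral_distr)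
  finally show ?thesis .
qed

lemma nn_integral_U_displacement:
  assumes F [measurable]: "F \<in> borel_measurable (borel \<Otimes>\<^sub>M config_space)"
  shows "(\<integral>\<^sup>+\<omega>. F (U \<omega>, displacement \<omega>) \<partial>M)
    = (\<integral>\<^sup>+v. (\<integral>\<^sup>+\<omega>. F (v, displacement \<omega>) \<partial>M) * indicator unit_tile v \<partial>lborel)"
proof -
  interpret U: prob_space "distr M borel U" by (rule prob_space_distr) measurable
  interpret Z: prob_space "distr M config_space displacement" by (rule prob_space_distr) measurable
  have "distr M (borel \<Otimes>\<^sub>M config_space) (\<lambda>\<omega>. (U \<omega>, displacement \<omega>)) = distr M borel U \<Otimes>\<^sub>M distr M config_space displacement"
    using distr_pair_indep_elements[OF U_Z_indep] by (simp add: displacement_def[abs_def])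
  then have "(\<integral>\<^sup>+\<omega>. F (U \<omega>, displacement \<omega>) \<partial>M) = (\<integral>\<^sup>+p. F p \<partial>(distr M borel U \<Otimes>\<^sub>M distr M config_space displacement))"
    by (simp add: nn_integral_distr flip: \<open>distr M (borel \<Otimes>\<^sub>M config_space) _ = _\<close>)
  also have "\<dots> = (\<integral>\<^sup>+v. (\<integral>\<^sup>+z. F (v, z) \<partial>distr M config_space displacement) \<partial>distr M borel U)"
    by (rule Z.nn_integral_fst[symmetric]) measurable
  also have "\<dots> = (\<integral>\<^sup>+v. (\<integral>\<^sup>+\<omega>. F (v, displacement \<omega>) \<partial>M) \<partial>distr M borel U)"
    by (intro nn_integral_cong) (simp add: nn_integral_distr)
  also have "\<dots> = (\<integral>\<^sup>+v. (\<integral>\<^sup>+\<omega>. F (v, displacement \<omega>) \<partial>M) * indicator unit_tile v \<partial>lborel)"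
    unfolding U_uniform by (rule nn_integral_uniform_cbox) measurable
  finally show ?thesis .
qed

text \<open>As \<open>w\<close> runs through the lattice and \<open>U\<close> through the tile,
  \<open>lattice_pt w + U\<close> sweeps out Lebesgue measure. Recentring the field at
  \<open>w\<close> does not change its law, by stationarity, and the field is independent of
  \<open>U\<close>; so location and recentred field decouple. The law of the process and both of its
  moments are computed from this formula.\<close>

lemma nn_integral_campbell:
  assumes F [measurable]: "F \<in> borel_measurable (borel \<Otimes>\<^sub>M config_space)"
  shows "(\<integral>\<^sup>+\<omega>. (\<integral>\<^sup>+w. F (lattice_pt w + U \<omega>, \<lambda>x. displacement \<omega> (x + w)) \<partial>count_space UNIV) \<partial>M)
    = (\<integral>\<^sup>+v. (\<integral>\<^sup>+\<omega>. F (v, displacement \<omega>) \<partial>M) \<partial>lborel)"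
proof -
  have sh: "(\<lambda>\<omega> x. displacement \<omega> (x + w)) \<in> M \<rightarrow>\<^sub>M config_space" for w
    using measurable_comp[OF displacement_measurable shift_config_measurable] by (simp add: o_def)
  have meas: "(\<lambda>\<omega>. F (lattice_pt w + U \<omega>, \<lambda>x. displacement \<omega> (x + w))) \<in> borel_measurable M" for w
    by (rule measurable_compose[OF measurable_Pair[OF _ sh] F]) measurable
  have F': "(\<lambda>(v, z). F (lattice_pt w + v, \<lambda>x. z (x + w))) \<in> borel_measurable (borel \<Otimes>\<^sub>M config_space)" for w
  proof -
    have "(\<lambda>p. F (lattice_pt w + fst p, (\<lambda>z x. z (x + w)) (snd p))) \<in> borel_measurable (borel \<Otimes>\<^sub>M config_space)"
      by (rule measurable_compose[OF measurable_Pair[OF _ measurable_compose[OF measurable_snd shift_config_measurable]] F])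
        measurable
    then show ?thesis by (simp add: case_prod_beta)
  qed
  have "(\<integral>\<^sup>+\<omega>. (\<integral>\<^sup>+w. F (lattice_pt w + U \<omega>, \<lambda>x. displacement \<omega> (x + w)) \<partial>count_space UNIV) \<partial>M)
      = (\<integral>\<^sup>+w. (\<integral>\<^sup>+\<omega>. F (lattice_pt w + U \<omega>, \<lambda>x. displacement \<omega> (x + w)) \<partial>M) \<partial>count_space UNIV)"
    by (intro nn_integral_count_space_nn_integral meas) simp
  also have "\<dots> = (\<integral>\<^sup>+w. (\<integral>\<^sup>+v. (\<integral>\<^sup>+\<omega>. F (lattice_pt w + v, displacement \<omega>) \<partial>M) * indicator unit_tile v \<partial>lborel) \<partial>count_space UNIV)"
  proof (rule nn_integral_cong)
    fix w
    have "(\<integral>\<^sup>+\<omega>. F (lattice_pt w + U \<omega>, \<lambda>x. displacement \<omega> (x + w)) \<partial>M)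
        = (\<integral>\<^sup>+v. (\<integral>\<^sup>+\<omega>. F (lattice_pt w + v, \<lambda>x. displacement \<omega> (x + w)) \<partial>M) * indicator unit_tile v \<partial>lborel)"
      using nn_integral_U_displacement[OF F', of w] by simp
    also have "\<dots> = (\<integral>\<^sup>+v. (\<integral>\<^sup>+\<omega>. F (lattice_pt w + v, displacement \<omega>) \<partial>M) * indicator unit_tile v \<partial>lborel)"
    proof (rule nn_integral_cong, rule arg_cong2[where f="(*)"])
      fix v
      show "(\<integral>\<^sup>+\<omega>. F (lattice_pt w + v, \<lambda>x. displacement \<omega> (x + w)) \<partial>M) = (\<integral>\<^sup>+\<omega>. F (lattice_pt w + v, displacement \<omega>) \<partial>M)"
        by (rule nn_integral_shift_displacement) measurable
    qed simp
    finally show "(\<integral>\<^sup>+\<omega>. F (lattice_pt w + U \<omega>, \<lambda>x. displacement \<omega> (x + w)) \<partial>M)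
        = (\<integral>\<^sup>+v. (\<integral>\<^sup>+\<omega>. F (lattice_pt w + v, displacement \<omega>) \<partial>M) * indicator unit_tile v \<partial>lborel)" .
  qed
  also have "\<dots> = (\<integral>\<^sup>+v. (\<integral>\<^sup>+\<omega>. F (v, displacement \<omega>) \<partial>M) \<partial>lborel)"
    by (rule nn_integral_lborel_tiling[symmetric]) measurable
  finally show ?thesis .
qed

section \<open>The law of the process under translations\<close>

lemma lattice_process_measurable [measurable]:
  "lattice_process \<in> M \<rightarrow>\<^sub>M measure_space_algebra"
  unfolding lattice_process_def by (rule measurable_dirac_sum) measurable

lemma shift_lattice_process_measurable [measurable]:
  "(\<lambda>\<omega>. shift_measure x (lattice_process \<omega>)) \<in> M \<rightarrow>\<^sub>M measure_space_algebra"
  unfolding lattice_process_def shift_dirac_sum by (rule measurable_dirac_sum) measurable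

lemma lattice_process_emeasure_measurable [measurable]:
  assumes "B \<in> sets borel"
  shows "(\<lambda>\<omega>. emeasure (lattice_process \<omega>) B) \<in> borel_measurable M"
  by (rule measurable_compose[OF lattice_process_measurable measurable_emeasure_measure_space_algebra[OF assms]])

text \<open>Moving the base point by a lattice vector while recentring the field at it merely
  relabels the points. The process is thus invariant under exactly the joint shifts that occur in
  Campbell's formula.\<close>

lemma dirac_sum_shift_displacement:
  "dirac_sum (\<lambda>x. lattice_pt x + (lattice_pt w + u) + displacement \<omega> (x + w))
    = dirac_sum (\<lambda>x. lattice_pt x + u + displacement \<omega> x)"
  using dirac_sum_reindex[of "\<lambda>x. x + w" "\<lambda>x. lattice_pt x + u + displacement \<omega> x"]
  by (simp add: lattice_pt_add bij_plus_right add_ac)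

text \<open>The right-hand side does not depend on \<open>x\<close>: this is the stationarity of the process.\<close>

lemma emeasure_distr_shift_lattice_process:
  fixes A :: "(real ^ 'n) measure set"
  assumes A [measurable]: "A \<in> sets measure_space_algebra"
  shows "emeasure (distr M measure_space_algebra (\<lambda>\<omega>. shift_measure x (lattice_process \<omega>))) A
    = (\<integral>\<^sup>+v. (\<integral>\<^sup>+\<omega>. indicator A (dirac_sum (\<lambda>x. lattice_pt x + v + displacement \<omega> x)) * indicator unit_tile v \<partial>M) \<partial>lborel)"
proof -
  \<comment> \<open>The factor \<open>indicator unit_tile v\<close> is a weight whose lattice
    translates sum to 1. Summing \<open>G\<close> over all joint shifts therefore returns the
    original indicator, which brings the expectation into the form of Campbell's formula.\<close>
  define G where "G v z = (indicator A (dirac_sum (\<lambda>x. lattice_pt x + v + z x)) * indicator unit_tile v :: ennreal)"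
    for v :: "real ^ 'n" and z :: "int ^ 'n \<Rightarrow> real ^ 'n"
  have [measurable]: "(\<lambda>p. dirac_sum (\<lambda>x. lattice_pt x + fst p + snd p x)) \<in> borel \<Otimes>\<^sub>M config_space \<rightarrow>\<^sub>M measure_space_algebra"
    by (rule measurable_dirac_sum) measurable
  have G [measurable]: "(\<lambda>p. G (fst p) (snd p)) \<in> borel_measurable (borel \<Otimes>\<^sub>M config_space)"
    unfolding G_def by measurable
  have "(\<lambda>p. (fst p - x, snd p)) \<in> borel \<Otimes>\<^sub>M config_space \<rightarrow>\<^sub>M borel \<Otimes>\<^sub>M config_space"
    by measurable
  from measurable_compose[OF this G]
  have Gx: "(\<lambda>p. G (fst p - x) (snd p)) \<in> borel_measurable (borel \<Otimes>\<^sub>M config_space)"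
    by simp
  have "emeasure (distr M measure_space_algebra (\<lambda>\<omega>. shift_measure x (lattice_process \<omega>))) A
      = (\<integral>\<^sup>+\<omega>. indicator A (shift_measure x (lattice_process \<omega>)) \<partial>M)"
    by (simp add: nn_integral_distr flip: nn_integral_indicator)
  also have "\<dots> = (\<integral>\<^sup>+\<omega>. (\<integral>\<^sup>+w. G (lattice_pt w + U \<omega> - x) (\<lambda>x. displacement \<omega> (x + w)) \<partial>count_space UNIV) \<partial>M)"
  proof (intro nn_integral_cong)
    fix \<omega>
    have G_eq: "G (lattice_pt w + U \<omega> - x) (\<lambda>x. displacement \<omega> (x + w))
       = indicator A (shift_measure x (lattice_process \<omega>)) * indicator unit_tile ((U \<omega> - x) - lattice_pt (- w))" for w
    proof -
      have "shift_measure x (lattice_process \<omega>) = dirac_sum (\<lambda>y. lattice_pt y + (U \<omega> - x) + displacement \<omega> y)"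
        by (simp add: lattice_process_def shift_dirac_sum displacement_def algebra_simps)
      also have "\<dots> = dirac_sum (\<lambda>y. lattice_pt y + (lattice_pt w + (U \<omega> - x)) + displacement \<omega> (y + w))"
        by (rule dirac_sum_shift_displacement[symmetric])
      finally show ?thesis
        by (simp add: G_def lattice_pt_minus algebra_simps)
    qed
    have "(\<integral>\<^sup>+w. G (lattice_pt w + U \<omega> - x) (\<lambda>x. displacement \<omega> (x + w)) \<partial>count_space UNIV)
       = (\<integral>\<^sup>+w. indicator A (shift_measure x (lattice_process \<omega>)) * indicator unit_tile ((U \<omega> - x) - lattice_pt (- w)) \<partial>count_space UNIV)"
      by (simp only: G_eq)
    also have "\<dots> = (\<integral>\<^sup>+w. indicator A (shift_measure x (lattice_process \<omega>)) * indicator unit_tile ((U \<omega> - x) - lattice_pt w) \<partial>count_space UNIV)"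
      by (rule nn_integral_bij_count_space) (simp add: bij_uminus)
    finally show "indicator A (shift_measure x (lattice_process \<omega>)) =
         (\<integral>\<^sup>+w. G (lattice_pt w + U \<omega> - x) (\<lambda>x. displacement \<omega> (x + w)) \<partial>count_space UNIV)"
      by (simp add: nn_integral_count_space_unit_tile)
  qed
  also have "\<dots> = (\<integral>\<^sup>+v. (\<integral>\<^sup>+\<omega>. G (v - x) (displacement \<omega>) \<partial>M) \<partial>lborel)"
    using nn_integral_campbell[OF Gx] by simp
  \<comment> \<open>Only here does \<open>x\<close> disappear: the location variable now ranges over
    all of space, and Lebesgue measure is translation invariant.\<close>
  also have "\<dots> = (\<integral>\<^sup>+v. (\<integral>\<^sup>+\<omega>. G v (displacement \<omega>) \<partial>M) \<partial>lborel)"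
  proof -
    have "(\<lambda>p. G (fst (fst p, displacement (snd p))) (snd (fst p, displacement (snd p)))) \<in> borel_measurable (borel \<Otimes>\<^sub>M M)"
      by (rule measurable_compose[OF _ G]) measurable
    then have "(\<lambda>v. \<integral>\<^sup>+\<omega>. G v (displacement \<omega>) \<partial>M) \<in> borel_measurable borel"
      by (intro borel_measurable_nn_integral) (simp add: case_prod_beta')
    from nn_integral_translate_lborel[OF this, of "- x"] show ?thesis
      by simp
  qed
  finally show ?thesis
    by (simp add: G_def)
qed

text \<open>The displacement of the point with index \<open>w\<close> is the value at 0 of the field
  recentred at \<open>w\<close>, so Campbell's formula applies. The process has intensity
  one.\<close>

lemma nn_integral_lattice_process_emeasure:
  assumes [measurable]: "B \<in> sets borel"
  shows "(\<integral>\<^sup>+\<omega>. emeasure (lattice_process \<omega>) B \<partial>M) = emeasure lborel B"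
proof -
  interpret LM: pair_sigma_finite lborel M ..
  have "(\<lambda>p. indicator B (fst p + snd p 0) :: ennreal) \<in> borel_measurable (borel \<Otimes>\<^sub>M config_space)"
    by measurable
  from nn_integral_campbell[OF this]
  have "(\<integral>\<^sup>+\<omega>. emeasure (lattice_process \<omega>) B \<partial>M) = (\<integral>\<^sup>+v. (\<integral>\<^sup>+\<omega>. indicator B (v + Z 0 \<omega>) \<partial>M) \<partial>lborel)"
    by (simp add: lattice_process_def emeasure_dirac_sum_indicator displacement_def)
  also have "\<dots> = (\<integral>\<^sup>+\<omega>. (\<integral>\<^sup>+v. indicator B (v + Z 0 \<omega>) \<partial>lborel) \<partial>M)"
    by (rule LM.Fubini'[symmetric]) measurable
  also have "\<dots> = (\<integral>\<^sup>+\<omega>. emeasure lborel B \<partial>M)"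
  proof (rule nn_integral_cong)
    fix \<omega>
    show "(\<integral>\<^sup>+v. indicator B (v + Z 0 \<omega>) \<partial>lborel) = emeasure lborel B"
      using nn_integral_translate_lborel[of "indicator B" "Z 0 \<omega>"] by (simp add: add.commute)
  qed
  finally show ?thesis
    by (simp add: emeasure_space_1)
qed

text \<open>Ordered pairs of points, the diagonal included, are indexed as \<open>w\<close> and
  \<open>y + w\<close>. Campbell's formula absorbs the sum over \<open>w\<close>, and integrating
  out the location of the first point leaves the covariogram at the difference of the two
  points.\<close>

lemma nn_integral_lattice_process_square:
  assumes [measurable]: "B \<in> sets borel" and B: "bounded B"
  shows "(\<integral>\<^sup>+\<omega>. (emeasure (lattice_process \<omega>) B)\<^sup>2 \<partial>M)
    = (\<integral>\<^sup>+y. (\<integral>\<^sup>+\<omega>. ennreal (overlap B (lattice_pt y + Z y \<omega> - Z 0 \<omega>)) \<partial>M) \<partial>count_space UNIV)"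
proof -
  interpret LM: pair_sigma_finite lborel M ..
  interpret C: sigma_finite_measure "count_space (UNIV :: (int ^ 'n) set)"
    by (rule sigma_finite_measure_count_space)
  define G where "G y v z = (indicator B (v + z 0) * indicator B (lattice_pt y + v + z y) :: ennreal)"
    for y :: "int ^ 'n" and v :: "real ^ 'n" and z :: "int ^ 'n \<Rightarrow> real ^ 'n"
  have [measurable]: "(\<lambda>p. G y (fst p) (snd p)) \<in> borel_measurable (borel \<Otimes>\<^sub>M config_space)" for y
    unfolding G_def by measurable
  have [measurable]: "(\<lambda>(v, \<omega>). G y v (displacement \<omega>)) \<in> borel_measurable (borel \<Otimes>\<^sub>M M)" for y
    unfolding G_def displacement_def by measurable
  have [measurable]: "(\<lambda>p. G (snd p) (fst (fst p)) (snd (fst p)))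
      \<in> borel_measurable ((borel \<Otimes>\<^sub>M config_space) \<Otimes>\<^sub>M count_space UNIV)"
    by (rule measurable_compose_countable) measurable
  have G: "(\<lambda>p. \<integral>\<^sup>+y. G y (fst p) (snd p) \<partial>count_space UNIV) \<in> borel_measurable (borel \<Otimes>\<^sub>M config_space)"
    by (rule C.borel_measurable_nn_integral) (simp add: case_prod_beta')
  have sq: "(emeasure (lattice_process \<omega>) B)\<^sup>2
      = (\<integral>\<^sup>+w. (\<integral>\<^sup>+y. G y (lattice_pt w + U \<omega>) (\<lambda>x. displacement \<omega> (x + w)) \<partial>count_space UNIV) \<partial>count_space UNIV)" for \<omega>
  proof -
    let ?p = "\<lambda>x. indicator B (lattice_pt x + U \<omega> + Z x \<omega>) :: ennreal"
    have "(\<integral>\<^sup>+y. G y (lattice_pt w + U \<omega>) (\<lambda>x. displacement \<omega> (x + w)) \<partial>count_space UNIV)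
        = ?p w * (\<integral>\<^sup>+y. ?p y \<partial>count_space UNIV)" for w
    proof -
      have "(\<integral>\<^sup>+y. G y (lattice_pt w + U \<omega>) (\<lambda>x. displacement \<omega> (x + w)) \<partial>count_space UNIV)
          = (\<integral>\<^sup>+y. ?p w * ?p (y + w) \<partial>count_space UNIV)"
        by (intro nn_integral_cong) (simp add: G_def displacement_def lattice_pt_add add_ac)
      also have "\<dots> = (\<integral>\<^sup>+y. ?p w * ?p y \<partial>count_space UNIV)"
        by (rule nn_integral_bij_count_space) (simp add: bij_plus_right)
      finally show ?thesis
        by (simp add: nn_integral_cmult)
    qed
    then show ?thesis
      by (simp add: lattice_process_def emeasure_dirac_sum_indicator nn_integral_multc power2_eq_square)
  qed
  have "(\<integral>\<^sup>+\<omega>. (emeasure (lattice_process \<omega>) B)\<^sup>2 \<partial>M)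
      = (\<integral>\<^sup>+v. (\<integral>\<^sup>+\<omega>. (\<integral>\<^sup>+y. G y v (displacement \<omega>) \<partial>count_space UNIV) \<partial>M) \<partial>lborel)"
    using nn_integral_campbell[OF G] by (simp add: sq)
  also have "\<dots> = (\<integral>\<^sup>+v. (\<integral>\<^sup>+y. (\<integral>\<^sup>+\<omega>. G y v (displacement \<omega>) \<partial>M) \<partial>count_space UNIV) \<partial>lborel)"
    by (rule nn_integral_cong, rule nn_integral_count_space_nn_integral) auto
  also have "\<dots> = (\<integral>\<^sup>+y. (\<integral>\<^sup>+v. (\<integral>\<^sup>+\<omega>. G y v (displacement \<omega>) \<partial>M) \<partial>lborel) \<partial>count_space UNIV)"
    by (rule nn_integral_count_space_nn_integral) auto
  also have "\<dots> = (\<integral>\<^sup>+y. (\<integral>\<^sup>+\<omega>. (\<integral>\<^sup>+v. G y v (displacement \<omega>) \<partial>lborel) \<partial>M) \<partial>count_space UNIV)"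
    by (intro nn_integral_cong LM.Fubini'[symmetric]) measurable
  also have "\<dots> = (\<integral>\<^sup>+y. (\<integral>\<^sup>+\<omega>. ennreal (overlap B (lattice_pt y + Z y \<omega> - Z 0 \<omega>)) \<partial>M) \<partial>count_space UNIV)"
  proof (rule nn_integral_cong, rule nn_integral_cong)
    fix y \<omega>
    have "(\<integral>\<^sup>+v. G y v (displacement \<omega>) \<partial>lborel) = (\<integral>\<^sup>+v. G y (- Z 0 \<omega> + v) (displacement \<omega>) \<partial>lborel)"
      by (rule nn_integral_translate_lborel[symmetric]) (simp add: G_def)
    also have "\<dots> = (\<integral>\<^sup>+v. indicator B v * indicator B (v + (lattice_pt y + Z y \<omega> - Z 0 \<omega>)) \<partial>lborel)"
      by (simp add: G_def displacement_def algebra_simps)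
    also have "\<dots> = ennreal (overlap B (lattice_pt y + Z y \<omega> - Z 0 \<omega>))"
      using B by (simp add: ennreal_overlap)
    finally show "(\<integral>\<^sup>+v. G y v (displacement \<omega>) \<partial>lborel) = ennreal (overlap B (lattice_pt y + Z y \<omega> - Z 0 \<omega>))" .
  qed
  finally show ?thesis .
qed

text \<open>Finite expected counts in the countably many balls of integer radius yield a single null
  set, off which every bounded set contains finitely many points.\<close>

lemma AE_locally_finite_counting_lattice_process:
  "AE \<omega> in M. locally_finite_counting (lattice_process \<omega>)"
proof -
  have "AE \<omega> in M. \<forall>n::nat. emeasure (lattice_process \<omega>) (cball 0 (real n)) \<noteq> \<infinity>"
  proof (subst AE_all_countable, rule allI, rule nn_integral_PInf_AE)
    fix n :: nat
    show "(\<integral>\<^sup>+\<omega>. emeasure (lattice_process \<omega>) (cball 0 (real n)) \<partial>M) \<noteq> \<infinity>"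
      using emeasure_lborel_cball_finite[of "0 :: real ^ 'n" n]
      by (simp add: nn_integral_lattice_process_emeasure)
    show "(\<lambda>\<omega>. emeasure (lattice_process \<omega>) (cball 0 (real n))) \<in> borel_measurable M"
      by (rule lattice_process_emeasure_measurable) simp
  qed
  then show ?thesis
  proof eventually_elim
    fix \<omega> assume fin: "\<forall>n::nat. emeasure (lattice_process \<omega>) (cball 0 (real n)) \<noteq> \<infinity>"
    show "locally_finite_counting (lattice_process \<omega>)"
      unfolding locally_finite_counting_def
    proof (intro conjI ballI impI)
      show "sets (lattice_process \<omega>) = sets borel"
        by (simp add: lattice_process_def)
      fix B :: "(real ^ 'n) set" assume [measurable]: "B \<in> sets borel" and "bounded B"
      then obtain n :: nat where n: "B \<subseteq> cball 0 (real n)"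
        by (metis bounded_iff mem_cball_0 order_trans real_arch_simple subsetI)
      let ?p = "\<lambda>x. lattice_pt x + U \<omega> + Z x \<omega>"
      have eq: "emeasure (lattice_process \<omega>) B = emeasure (count_space UNIV) (?p -` B)"
        by (simp add: lattice_process_def dirac_sum_def emeasure_distr)
      moreover have "emeasure (lattice_process \<omega>) B \<le> emeasure (lattice_process \<omega>) (cball 0 (real n))"
        using n by (intro emeasure_mono) (simp_all add: lattice_process_def)
      ultimately have "finite (?p -` B)"
        using fin[rule_format, of n] by (auto simp: emeasure_count_space top_unique split: if_splits)
      then show "emeasure (lattice_process \<omega>) B \<in> range of_nat"
        by (simp add: eq emeasure_count_space_finite)
    qed
  qed
qed

lemma stationary_lattice_process: "stationary_point_process M lattice_process"
  unfolding stationary_point_process_def point_process_def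
proof (intro conjI allI)
  \<comment> \<open>The case \<open>x = 0\<close> of the formula for shifted processes describes the
    law of the process itself.\<close>
  have "shift_measure 0 (lattice_process \<omega>) = lattice_process \<omega>" for \<omega>
    unfolding lattice_process_def shift_dirac_sum by simp
  note 0 = emeasure_distr_shift_lattice_process[of _ 0, unfolded this]
  show "distr M measure_space_algebra (\<lambda>\<omega>. shift_measure x (lattice_process \<omega>))
      = distr M measure_space_algebra lattice_process" for x
    by (rule measure_eqI) (simp_all add: emeasure_distr_shift_lattice_process 0)
qed (simp_all add: AE_locally_finite_counting_lattice_process)

end

section \<open>The overlap function\<close>

lemma overlap_nonneg: "0 \<le> overlap B t"
  by (simp add: overlap_def)

lemma overlap_le_measure:
  fixes B :: "'b::euclidean_space set"
  assumes "B \<in> sets borel" "bounded B"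
  shows "overlap B t \<le> measure lborel B"
proof -
  have "(\<lambda>v. v + t) -` B \<in> sets borel"
    using assms measurable_sets[of "\<lambda>v. v + t" borel borel B] by simp
  then show ?thesis
    unfolding overlap_def using assms emeasure_bounded_finite[of B]
    by (intro measure_mono_fmeasurable fmeasurableI) auto
qed

lemma overlap_0: "overlap B 0 = measure lborel B"
proof -
  have "(\<lambda>v. v + 0) -` B = B" by auto
  then show ?thesis by (simp add: overlap_def)
qed

lemma overlap_eq_integral:
  fixes B :: "'b::euclidean_space set"
  assumes [measurable]: "B \<in> sets borel"
  shows "overlap B t = (\<integral>v. indicator B v * indicator B (v + t) \<partial>lborel)"
proof -
  have "(\<lambda>v. v + t) -` B \<in> sets borel"
    using measurable_sets[of "\<lambda>v. v + t" borel borel B] by simp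
  then have "overlap B t = (\<integral>v. indicator (B \<inter> (\<lambda>v. v + t) -` B) v \<partial>lborel)"
    by (simp add: overlap_def)
  also have "\<dots> = (\<integral>v. indicator B v * indicator B (v + t) \<partial>lborel)"
    by (intro Bochner_Integration.integral_cong) (auto simp: indicator_def)
  finally show ?thesis .
qed

lemma integrable_indicator_bounded:
  fixes B :: "'b::euclidean_space set"
  assumes "B \<in> sets borel" "bounded B"
  shows "integrable lborel (indicator B :: 'b \<Rightarrow> real)"
  using assms emeasure_bounded_finite[of B] by (intro integrable_real_indicator) auto

text \<open>A convex set has a null frontier, so for almost every \<open>v\<close> the indicator of
  \<open>B\<close> is locally constant at \<open>v + t\<close>. Dominated convergence does the
  rest.\<close>

lemma isCont_overlap:
  fixes B :: "'b::euclidean_space set"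
  assumes B [measurable]: "B \<in> sets borel" and "bounded B" "convex B"
  shows "isCont (overlap B) t"
proof -
  have "frontier B \<in> null_sets lborel"
    using negligible_convex_frontier[OF \<open>convex B\<close>]
    by (auto simp: negligible_iff_null_sets null_sets_completion_iff)
  then have "AE v in distr lborel borel ((+) t). v \<notin> frontier B"
    by (simp add: lborel_distr_plus AE_not_in)
  then have AE: "AE v in lborel. t + v \<notin> frontier B"
    by (subst (asm) AE_distr_iff) (auto simp flip: Compl_eq)
  show ?thesis
    unfolding continuous_at_sequentially
  proof (intro allI impI)
    fix X :: "nat \<Rightarrow> 'b" assume X: "X \<longlonglongrightarrow> t"
    have "(\<lambda>n. \<integral>v. indicator B v * indicator B (v + X n) \<partial>lborel)
        \<longlonglongrightarrow> (\<integral>v. indicator B v * indicator B (v + t) \<partial>lborel :: real)"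
    proof (rule integral_dominated_convergence)
      show "AE v in lborel. (\<lambda>n. indicator B v * indicator B (v + X n) :: real)
          \<longlonglongrightarrow> indicator B v * indicator B (v + t)"
        using AE
      proof eventually_elim
        fix v assume v: "t + v \<notin> frontier B"
        have lim: "(\<lambda>n. v + X n) \<longlonglongrightarrow> v + t"
          by (intro tendsto_intros X)
        have "v + t \<in> interior B \<or> v + t \<in> - closure B"
          using v by (auto simp: frontier_def add.commute)
        then have "\<forall>\<^sub>F n in sequentially. indicator B (v + X n) = (indicator B (v + t) :: real)"
        proof
          assume "v + t \<in> interior B"
          moreover from this have "\<forall>\<^sub>F n in sequentially. v + X n \<in> interior B"
            using topological_tendstoD[OF lim open_interior] by blast
          ultimately show ?thesis
            using interior_subset[of B] by (auto elim!: eventually_mono simp: indicator_def subset_iff)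
        next
          assume "v + t \<in> - closure B"
          moreover from this have "\<forall>\<^sub>F n in sequentially. v + X n \<in> - closure B"
            using topological_tendstoD[OF lim] by (metis open_Compl closed_closure)
          ultimately show ?thesis
            using closure_subset[of B] by (auto elim!: eventually_mono simp: indicator_def subset_iff)
        qed
        then have "(\<lambda>n. indicator B (v + X n) :: real) \<longlonglongrightarrow> indicator B (v + t)"
          by (rule tendsto_eventually)
        then show "(\<lambda>n. indicator B v * indicator B (v + X n) :: real)
          \<longlonglongrightarrow> indicator B v * indicator B (v + t)"
          by (rule tendsto_mult_left)
      qed
      show "integrable lborel (indicator B :: 'b \<Rightarrow> real)"
        using assms by (intro integrable_indicator_bounded)
    qed (auto simp: indicator_def)
    then show "(overlap B \<circ> X) \<longlonglongrightarrow> overlap B t"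
      by (simp add: o_def overlap_eq_integral)
  qed
qed

lemma borel_measurable_overlap:
  fixes B :: "'b::euclidean_space set"
  assumes "B \<in> sets borel" "bounded B" "convex B"
  shows "overlap B \<in> borel_measurable borel"
  using isCont_overlap[OF assms]
  by (intro borel_measurable_continuous_onI continuous_at_imp_continuous_on) blast

section \<open>Behaviour of overlaps, volumes and Fourier transforms under dilation\<close>

lemma integral_lborel_scaleR:
  fixes f :: "'b::euclidean_space \<Rightarrow> 'c::{banach, second_countable_topology}"
  assumes [measurable]: "f \<in> borel_measurable borel" and "0 < c"
  shows "(\<integral>x. f x \<partial>lborel) = c ^ DIM('b) *\<^sub>R (\<integral>x. f (c *\<^sub>R x) \<partial>lborel)"
proof -
  have "(\<integral>x. f x \<partial>lborel) = (\<integral>x. f x \<partial>density (distr lborel borel (\<lambda>x. 0 + c *\<^sub>R x)) (\<lambda>_. ennreal (\<bar>c\<bar> ^ DIM('b))))"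
    using \<open>0 < c\<close> by (subst lborel_affine[of c 0]) auto
  also have "\<dots> = (\<integral>x. c ^ DIM('b) *\<^sub>R f x \<partial>distr lborel borel (\<lambda>x. 0 + c *\<^sub>R x))"
    using \<open>0 < c\<close> by (subst integral_density) auto
  also have "\<dots> = c ^ DIM('b) *\<^sub>R (\<integral>x. f (c *\<^sub>R x) \<partial>lborel)"
    by (subst integral_distr) auto
  finally show ?thesis .
qed

lemma scaleR_image_borel:
  fixes B :: "'b::euclidean_space set"
  assumes "B \<in> sets borel" and "0 < r"
  shows "(*\<^sub>R) r ` B \<in> sets borel"
proof -
  have "(*\<^sub>R) r ` B = (\<lambda>x. x /\<^sub>R r) -` B"
    using \<open>0 < r\<close> by (force simp: image_iff)
  then show ?thesis
    using assms measurable_sets[of "\<lambda>x. x /\<^sub>R r" borel borel B] by simp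
qed

lemma indicator_scaleR_image:
  fixes x :: "'b::real_vector"
  assumes "0 < r"
  shows "indicator ((*\<^sub>R) r ` B) (r *\<^sub>R x) = indicator B x"
proof -
  have "r *\<^sub>R x \<in> (*\<^sub>R) r ` B \<longleftrightarrow> x \<in> B"
    using assms scaleR_left_imp_eq[of r x] by (auto simp: image_iff)
  then show ?thesis
    by (simp add: indicator_def)
qed

lemma overlap_scaleR_image:
  fixes B :: "'b::euclidean_space set"
  assumes [measurable]: "B \<in> sets borel" and "0 < r"
  shows "overlap ((*\<^sub>R) r ` B) t = r ^ DIM('b) * overlap B (t /\<^sub>R r)"
proof -
  have [measurable]: "(*\<^sub>R) r ` B \<in> sets borel"
    using assms by (rule scaleR_image_borel)
  have eq: "r *\<^sub>R x + t = r *\<^sub>R (x + t /\<^sub>R r)" for x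
    using \<open>0 < r\<close> by (simp add: algebra_simps)
  have "overlap ((*\<^sub>R) r ` B) t
      = r ^ DIM('b) *\<^sub>R (\<integral>x. indicator ((*\<^sub>R) r ` B) (r *\<^sub>R x) * indicator ((*\<^sub>R) r ` B) (r *\<^sub>R x + t) \<partial>lborel)"
    unfolding overlap_eq_integral[OF \<open>(*\<^sub>R) r ` B \<in> sets borel\<close>]
    using \<open>0 < r\<close> by (rule integral_lborel_scaleR[rotated]) measurable
  also have "\<dots> = r ^ DIM('b) * overlap B (t /\<^sub>R r)"
    unfolding eq indicator_scaleR_image[OF \<open>0 < r\<close>] by (simp add: overlap_eq_integral)
  finally show ?thesis .
qed

lemma measure_scaleR_image:
  fixes W :: "'b::euclidean_space set"
  assumes "W \<in> sets borel" "0 < r"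
  shows "measure lborel ((*\<^sub>R) r ` W) = r ^ DIM('b) * measure lborel W"
  using overlap_scaleR_image[OF assms, of 0] by (simp add: overlap_0)

text \<open>On the scale \<open>r\<close> a fixed shift becomes \<open>t /\<^sub>R r\<close>, which
  tends to 0, where the overlap is continuous with value \<open>measure lborel W\<close>.\<close>

lemma tendsto_overlap_ratio:
  fixes W :: "'b::euclidean_space set"
  assumes W: "W \<in> sets borel" "bounded W" "convex W" and "measure lborel W \<noteq> 0"
  shows "((\<lambda>r. overlap W (t /\<^sub>R r) / measure lborel W) \<longlongrightarrow> 1) at_top"
proof -
  have "((\<lambda>r. inverse r *\<^sub>R t) \<longlongrightarrow> 0 *\<^sub>R t) at_top"
    by (intro tendsto_scaleR tendsto_inverse_0_at_top filterlim_ident tendsto_const)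
  then have "((\<lambda>r. t /\<^sub>R r) \<longlongrightarrow> 0) at_top"
    by simp
  from isCont_tendsto_compose[OF isCont_overlap[OF W] this]
  have "((\<lambda>r. overlap W (t /\<^sub>R r)) \<longlongrightarrow> measure lborel W) at_top"
    by (simp add: overlap_0)
  from tendsto_divide[OF this tendsto_const[of "measure lborel W"]] show ?thesis
    using assms(4) by simp
qed

lemma fourier_scaleR_image:
  fixes B :: "(real ^ 'n) set"
  assumes [measurable]: "B \<in> sets borel" and "0 < r"
  shows "fourier (indicator ((*\<^sub>R) r ` B)) k = r ^ CARD('n) *\<^sub>R fourier (indicator B) (r *\<^sub>R k)"
proof -
  have [measurable]: "(*\<^sub>R) r ` B \<in> sets borel"
    using assms by (rule scaleR_image_borel)
  have "fourier (indicator ((*\<^sub>R) r ` B)) k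
      = r ^ DIM(real ^ 'n) *\<^sub>R (\<integral>x. indicator ((*\<^sub>R) r ` B) (r *\<^sub>R x) * exp (- \<i> * complex_of_real (k \<bullet> (r *\<^sub>R x))) \<partial>lborel)"
    unfolding fourier_def using \<open>0 < r\<close> by (rule integral_lborel_scaleR[rotated]) measurable
  then show ?thesis
    unfolding indicator_scaleR_image[OF \<open>0 < r\<close>] by (simp add: fourier_def)
qed

section \<open>The Fejer kernel\<close>

text \<open>The Fejer kernel of period 1. As a squared modulus it is visibly nonnegative; for
  positive \<open>N\<close>, multiplied out, it is a trigonometric polynomial with coefficients in
  [0,1].\<close>

definition fejer :: "nat \<Rightarrow> real \<Rightarrow> real" where
  "fejer N s = (norm (\<Sum>m<N. cis (2 * pi * real m * s)))\<^sup>2 / N"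

lemma fejer_nonneg: "0 \<le> fejer N s"
  by (simp add: fejer_def)

lemma continuous_on_fejer: "continuous_on A (fejer N)"
  unfolding fejer_def by (cases "N = 0") (auto intro!: continuous_intros)

lemma borel_measurable_fejer [measurable]: "fejer N \<in> borel_measurable borel"
  by (intro borel_measurable_continuous_onI continuous_on_fejer)

lemma fejer_periodic: "fejer N (of_int k + s) = fejer N s"
proof -
  have "cis (2 * pi * real m * (of_int k + s)) = cis (2 * pi * real m * s)" for m
  proof -
    have "cis (2 * pi * real m * (of_int k + s)) = cis (2 * pi * (real m * of_int k)) * cis (2 * pi * real m * s)"
      by (simp add: cis_mult algebra_simps)
    then show ?thesis by simp
  qed
  then show ?thesis by (simp add: fejer_def)
qed

lemma fejer_eq_cos_sum:
  "fejer N s = (\<Sum>m<N. \<Sum>l<N. cos (2 * pi * (real m - real l) * s)) / N"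
proof -
  have "of_real ((norm (\<Sum>m<N. cis (2 * pi * real m * s)))\<^sup>2)
      = (\<Sum>m<N. \<Sum>l<N. cis (2 * pi * real m * s) * cnj (cis (2 * pi * real l * s)))"
    unfolding complex_norm_square cnj_sum sum_product by simp
  also have "\<dots> = (\<Sum>m<N. \<Sum>l<N. cis (2 * pi * (real m - real l) * s))"
    by (simp add: cis_cnj cis_mult algebra_simps)
  finally have "(norm (\<Sum>m<N. cis (2 * pi * real m * s)))\<^sup>2 = Re (\<Sum>m<N. \<Sum>l<N. cis (2 * pi * (real m - real l) * s))"
    by (metis Re_complex_of_real)
  then show ?thesis
    by (simp add: fejer_def)
qed

text \<open>All frequencies are integers, so over a full period only the \<open>N\<close> diagonal
  terms of the cosine sum survive, each contributing 1/N.\<close>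

lemma has_bochner_integral_fejer:
  assumes "0 < N"
  shows "has_bochner_integral lborel (\<lambda>s. indicator {-1/2..1/2} s * fejer N s) 1"
proof -
  have cos: "has_bochner_integral lborel (\<lambda>s. indicator {-1/2..1/2} s * cos (2 * pi * (real m - real l) * s))
      (if m = l then 1 else 0)" for m l
  proof (cases "m = l")
    case True
    then show ?thesis
      by (auto simp: has_bochner_integral_iff)
  next
    case False
    let ?c = "2 * pi * (real m - real l)"
    from False have c: "?c \<noteq> 0" by simp
    have "sin (?c / 2) = 0"
      using sin_zero_iff_int2[of "?c / 2"] by (auto intro!: exI[of _ "int m - int l"])
    moreover have "has_bochner_integral lborel (\<lambda>s. indicator {-1/2..1/2} s *\<^sub>R cos (?c * s))
        (sin (?c * (1/2)) / ?c - sin (?c * (-1/2)) / ?c)"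
    proof (rule has_bochner_integral_FTC_Icc)
      show "((\<lambda>s. sin (?c * s) / ?c) has_vector_derivative cos (?c * s)) (at s within {-1/2..1/2})" for s
        using c unfolding has_real_derivative_iff_has_vector_derivative[symmetric]
        by (auto intro!: derivative_eq_intros)
      show "continuous_on {-1/2..1/2} (\<lambda>s. cos (?c * s))"
        by (intro continuous_intros)
    qed simp
    ultimately show ?thesis
      using False by simp
  qed
  have "has_bochner_integral lborel
      (\<lambda>s. (\<Sum>m<N. \<Sum>l<N. indicator {-1/2..1/2} s * cos (2 * pi * (real m - real l) * s)) / N)
      ((\<Sum>m<N. \<Sum>l<N. if m = l then 1 else 0) / N)"
    by (intro has_bochner_integral_divide_zero has_bochner_integral_sum cos)
  then show ?thesis
    using assms by (simp add: fejer_eq_cos_sum sum_distrib_left)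
qed

text \<open>With z the exponential at \<open>s\<close>, the geometric sum is (1 - z^N)/(1 - z): the
  numerator has modulus at most 2, the denominator 2 |sin(pi s)|. For \<open>N = 0\<close> both
  sides are 0 by the convention for division.\<close>

lemma fejer_le:
  assumes "0 < \<delta>" "\<delta> \<le> \<bar>s\<bar>" "\<bar>s\<bar> \<le> 1/2"
  shows "fejer N s \<le> 1 / (N * (sin (pi * \<delta>))\<^sup>2)"
proof (cases "N = 0")
  case False
  let ?z = "cis (2 * pi * s)"
  have "sin (pi * \<delta>) \<le> sin (pi * \<bar>s\<bar>)"
  proof (rule sin_monotone_2pi_le)
    have "0 \<le> pi * \<delta>"
      using assms by simp
    then show "- (pi / 2) \<le> pi * \<delta>"
      using pi_gt_zero by linarith
  qed (use assms in \<open>auto simp: field_simps\<close>)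
  moreover have pos: "0 < sin (pi * \<delta>)"
    using assms by (intro sin_gt_zero) (auto simp: field_simps)
  ultimately have "(sin (pi * \<delta>))\<^sup>2 \<le> (sin (pi * \<bar>s\<bar>))\<^sup>2"
    by (intro power_mono) auto
  also have "\<dots> = (sin (pi * s))\<^sup>2"
    by (auto simp: abs_if)
  finally have sin: "(sin (pi * \<delta>))\<^sup>2 \<le> (sin (pi * s))\<^sup>2" .
  have "(norm (1 - ?z))\<^sup>2 = (1 - cos (2 * pi * s))\<^sup>2 + (sin (2 * pi * s))\<^sup>2"
    by (simp add: cmod_power2)
  also have "\<dots> = 2 - 2 * cos (2 * (pi * s))"
    using sin_cos_squared_add[of "2 * pi * s"] by (simp add: power2_eq_square algebra_simps)
  also have "\<dots> = 4 * (sin (pi * s))\<^sup>2"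
    unfolding cos_double_sin by simp
  finally have z: "(norm (1 - ?z))\<^sup>2 = 4 * (sin (pi * s))\<^sup>2" .
  have "norm (1 - ?z ^ N) \<le> 1 + 1"
    by (rule norm_triangle_le_diff) (simp add: norm_power)
  then have "(norm (1 - ?z ^ N))\<^sup>2 \<le> 2\<^sup>2"
    by (intro power_mono) auto
  moreover have "?z ^ m = cis (2 * pi * real m * s)" for m
    by (simp add: Complex.DeMoivre mult_ac)
  then have "1 - ?z ^ N = (1 - ?z) * (\<Sum>m<N. cis (2 * pi * real m * s))"
    using one_diff_power_eq[of ?z N] by (simp only:)
  ultimately have "4 * (sin (pi * s))\<^sup>2 * (norm (\<Sum>m<N. cis (2 * pi * real m * s)))\<^sup>2 \<le> 4"
    by (simp add: norm_mult power_mult_distrib z)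
  then have "(sin (pi * \<delta>))\<^sup>2 * (norm (\<Sum>m<N. cis (2 * pi * real m * s)))\<^sup>2 \<le> 1"
    using mult_right_mono[OF sin, of "(norm (\<Sum>m<N. cis (2 * pi * real m * s)))\<^sup>2"] by simp
  then have "(norm (\<Sum>m<N. cis (2 * pi * real m * s)))\<^sup>2 \<le> 1 / (sin (pi * \<delta>))\<^sup>2"
    using pos by (simp add: pos_le_divide_eq mult.commute)
  then have "fejer N s \<le> 1 / (sin (pi * \<delta>))\<^sup>2 / N"
    unfolding fejer_def by (rule divide_right_mono) simp
  then show ?thesis
    by (simp add: mult.commute)
qed (simp add: fejer_def)

definition fejer_mass :: "nat \<Rightarrow> real \<Rightarrow> real" where
  "fejer_mass N \<delta> = (\<integral>s. indicator {-\<delta>..\<delta>} s * fejer N s \<partial>lborel)"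

lemma fejer_mass_nonneg: "0 \<le> fejer_mass N \<delta>"
  unfolding fejer_mass_def by (intro integral_nonneg_AE AE_I2 mult_nonneg_nonneg fejer_nonneg) simp

lemma integrable_indicator_fejer: "integrable lborel (\<lambda>s. indicator {a..b} s * fejer N s)"
  using borel_integrable_compact[OF compact_Icc continuous_on_fejer, of a b N] by simp

text \<open>The mass over a period is 1, and the part farther than \<open>\<delta>\<close> from 0 is
  at most the uniform bound of \<open>fejer_le\<close> times the length 1. Hence the kernel
  concentrates at 0 as \<open>N\<close> grows with \<open>\<delta>\<close> fixed.\<close>

lemma fejer_mass_ge:
  assumes "0 < \<delta>" "\<delta> < 1/2" "0 < N"
  shows "1 - 1 / (N * (sin (pi * \<delta>))\<^sup>2) \<le> fejer_mass N \<delta>"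
proof -
  let ?C = "1 / (N * (sin (pi * \<delta>))\<^sup>2)"
  have int: "integrable lborel (\<lambda>s. ?C * indicator {-1/2..1/2::real} s)"
    by (intro integrable_mult_right integrable_indicator_bounded) auto
  have "1 = (\<integral>s. indicator {-1/2..1/2} s * fejer N s \<partial>lborel)"
    using has_bochner_integral_fejer[OF \<open>0 < N\<close>] by (simp only: has_bochner_integral_iff)
  also have "\<dots> \<le> (\<integral>s. indicator {-\<delta>..\<delta>} s * fejer N s + ?C * indicator {-1/2..1/2} s \<partial>lborel)"
  proof (rule integral_mono)
    fix s :: real
    consider "s \<in> {-\<delta>..\<delta>}" | "s \<notin> {-1/2..1/2}" | "\<delta> \<le> \<bar>s\<bar>" "\<bar>s\<bar> \<le> 1/2"
      by force
    then show "indicator {-1/2..1/2} s * fejer N s \<le> indicator {-\<delta>..\<delta>} s * fejer N s + ?C * indicator {-1/2..1/2} s"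
    proof cases
      case 1
      then show ?thesis
        using fejer_nonneg[of N s] assms by simp
    next
      case 2
      then show ?thesis
        using fejer_nonneg[of N s] by simp
    next
      case 3
      then show ?thesis
        using fejer_le[OF \<open>0 < \<delta>\<close> 3, of N] fejer_nonneg[of N s] by (simp add: indicator_def abs_le_iff)
    qed
  qed (intro integrable_indicator_fejer int Bochner_Integration.integrable_add)+
  also have "\<dots> = fejer_mass N \<delta> + (\<integral>s. ?C * indicator {-1/2..1/2::real} s \<partial>lborel)"
    unfolding fejer_mass_def
    by (rule Bochner_Integration.integral_add) (intro integrable_indicator_fejer int)+
  also have "(\<integral>s. ?C * indicator {-1/2..1/2::real} s \<partial>lborel) = ?C"
    by simp
  finally show ?thesis by simp
qed

section \<open>The product kernel in several dimensions\<close>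

definition fejer_vec :: "nat \<Rightarrow> real ^ 'n \<Rightarrow> real" where
  "fejer_vec N s = (\<Prod>j\<in>UNIV. fejer N (s $ j))"

lemma fejer_vec_nonneg: "0 \<le> fejer_vec N s"
  by (simp add: fejer_vec_def prod_nonneg fejer_nonneg)

lemma fejer_vec_periodic: "fejer_vec N (lattice_pt k + s) = fejer_vec N s"
  by (simp add: fejer_vec_def lattice_pt_def fejer_periodic)

lemma borel_measurable_fejer_vec [measurable]: "fejer_vec N \<in> borel_measurable borel"
  unfolding fejer_vec_def by measurable

text \<open>Multiplying out produces differences of exponent vectors, hence integer vectors, so with
  the factor 2 pi only frequencies of the dual lattice occur. The sum is not grouped by frequency:
  the later estimate only uses that \<open>b\<close> determines the frequency injectively once
  \<open>a\<close> is fixed.\<close>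

lemma fejer_vec_eq_sum:
  fixes s :: "real ^ 'n" and N :: nat
  defines "A \<equiv> (UNIV :: 'n set) \<rightarrow>\<^sub>E {..<N}"
  shows "of_real (fejer_vec N s)
    = (\<Sum>a\<in>A. \<Sum>b\<in>A. cis (2 * pi * (lattice_pt (\<chi> j. int (a j) - int (b j)) \<bullet> s))) / of_real (real N ^ CARD('n))"
proof -
  let ?e = "\<lambda>a. cis (2 * pi * (\<Sum>j\<in>UNIV. real (a j) * s $ j))"
  have cis_sum: "(\<Prod>j\<in>J. cis (f j)) = cis (\<Sum>j\<in>J. f j)" for f and J :: "'n set"
    by (induction J rule: infinite_finite_induct) (auto simp: cis_mult)
  have "(\<Prod>j\<in>UNIV. \<Sum>m<N. cis (2 * pi * real m * s $ j)) = (\<Sum>a\<in>A. ?e a)"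
    unfolding A_def by (subst prod_sum_PiE) (auto simp: cis_sum sum_distrib_left mult_ac)
  then have "of_real ((norm (\<Prod>j\<in>UNIV. \<Sum>m<N. cis (2 * pi * real m * s $ j)))\<^sup>2)
      = (\<Sum>a\<in>A. \<Sum>b\<in>A. ?e a * cnj (?e b))"
    unfolding complex_norm_square by (simp add: sum_product)
  also have "\<dots> = (\<Sum>a\<in>A. \<Sum>b\<in>A. cis (2 * pi * (lattice_pt (\<chi> j. int (a j) - int (b j)) \<bullet> s)))"
    by (simp add: cis_cnj cis_mult inner_vec_def lattice_pt_def sum_subtractf left_diff_distrib algebra_simps)
  finally have sq: "complex_of_real ((norm (\<Prod>j\<in>UNIV. \<Sum>m<N. cis (2 * pi * real m * s $ j)))\<^sup>2) = \<dots>" .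
  have "fejer_vec N s = (norm (\<Prod>j\<in>UNIV. \<Sum>m<N. cis (2 * pi * real m * s $ j)))\<^sup>2 / real N ^ CARD('n)"
    by (simp add: fejer_vec_def fejer_def prod_dividef prod_power_distrib flip: prod_norm)
  then show ?thesis
    by (simp only: of_real_divide sq)
qed

text \<open>A ball of the maximum norm, so that integrals of the product kernel factorise. Unlike
  \<open>unit_tile\<close> it is centred at 0, where the kernel peaks.\<close>

definition centred_box :: "real \<Rightarrow> (real ^ 'n) set" where
  "centred_box \<delta> = {s. \<forall>j. s $ j \<in> {-\<delta>..\<delta>}}"

lemma sets_centred_box [measurable]: "centred_box \<delta> \<in> sets borel"
  unfolding centred_box_def by measurable

text \<open>Box and kernel are both products over the coordinates, so the one-dimensional masses
  multiply.\<close>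

lemma has_bochner_integral_fejer_vec:
  "has_bochner_integral lborel (\<lambda>s :: real ^ 'n. indicator (centred_box \<delta>) s * fejer_vec N s) (fejer_mass N \<delta> ^ CARD('n))"
proof (rule has_bochner_integral_nn_integral)
  let ?f = "\<lambda>(_ :: real ^ 'n) s. ennreal (indicator {-\<delta>..\<delta>} s * fejer N s)"
  have B: "(\<Prod>b\<in>Basis. F b) = (\<Prod>j\<in>UNIV. F (axis j 1))" for F :: "real ^ 'n \<Rightarrow> 'c::comm_monoid_mult"
  proof -
    have "(Basis :: (real ^ 'n) set) = range (\<lambda>j. axis j 1)"
      by (auto simp: Basis_vec_def)
    moreover have "prod F (range (\<lambda>j. axis j 1)) = prod (F \<circ> (\<lambda>j. axis j 1)) UNIV"
      by (rule prod.reindex) (auto simp: inj_on_def axis_eq_axis)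
    ultimately show ?thesis
      by (simp only: o_def)
  qed
  have "(\<integral>\<^sup>+s. ennreal (indicator (centred_box \<delta>) s * fejer_vec N s) \<partial>(lborel :: (real ^ 'n) measure))
      = (\<integral>\<^sup>+s. (\<Prod>b\<in>Basis. ?f b (s \<bullet> b)) \<partial>(lborel :: (real ^ 'n) measure))"
  proof (rule nn_integral_cong)
    fix s :: "real ^ 'n"
    have "indicator (centred_box \<delta>) s = (\<Prod>j\<in>UNIV. indicator {-\<delta>..\<delta>} (s $ j) :: real)"
    proof (cases "s \<in> centred_box \<delta>")
      case False
      then obtain j where "s $ j \<notin> {-\<delta>..\<delta>}"
        by (auto simp: centred_box_def)
      then have "(\<Prod>j\<in>UNIV. indicator {-\<delta>..\<delta>} (s $ j) :: real) = 0"
        by (intro prod_zero) (auto intro!: exI[of _ j])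
      with False show ?thesis by simp
    qed (simp add: centred_box_def)
    then have "indicator (centred_box \<delta>) s * fejer_vec N s = (\<Prod>j\<in>UNIV. indicator {-\<delta>..\<delta>} (s $ j) * fejer N (s $ j))"
      by (simp only: fejer_vec_def prod.distrib)
    also have "ennreal \<dots> = (\<Prod>j\<in>UNIV. ennreal (indicator {-\<delta>..\<delta>} (s $ j) * fejer N (s $ j)))"
      by (rule prod_ennreal[symmetric]) (simp add: fejer_nonneg)
    also have "\<dots> = (\<Prod>b\<in>Basis. ?f b (s \<bullet> b))"
      unfolding B by (simp only: inner_axis inner_real_def mult_1_right)
    finally show "ennreal (indicator (centred_box \<delta>) s * fejer_vec N s) = (\<Prod>b\<in>Basis. ?f b (s \<bullet> b))" .
  qed
  also have "\<dots> = (\<Prod>b\<in>(Basis :: (real ^ 'n) set). (\<integral>\<^sup>+s. ennreal (indicator {-\<delta>..\<delta>} s * fejer N s) \<partial>lborel))"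
    by (rule nn_integral_lborel_prod) auto
  also have "\<dots> = (\<Prod>b\<in>(Basis :: (real ^ 'n) set). ennreal (fejer_mass N \<delta>))"
    unfolding fejer_mass_def
    by (subst nn_integral_eq_integral[OF integrable_indicator_fejer]) (simp_all add: fejer_nonneg)
  also have "\<dots> = ennreal (fejer_mass N \<delta> ^ CARD('n))"
    by (simp add: ennreal_power fejer_mass_nonneg)
  finally show "(\<integral>\<^sup>+s. ennreal (indicator (centred_box \<delta>) s * fejer_vec N (s :: real ^ 'n)) \<partial>lborel) = ennreal (fejer_mass N \<delta> ^ CARD('n))" .
qed (simp_all add: fejer_vec_nonneg fejer_mass_nonneg)

section \<open>Lattice sums of the overlap function\<close>

lemma fourier_eq_cis:
  "fourier (indicator B) k = (\<integral>x. indicator B x * cis (- (k \<bullet> x)) \<partial>lborel)"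
  by (simp add: fourier_def cis_conv_exp)

lemma fourier_minus: "fourier (indicator B) (- k) = cnj (fourier (indicator B) k)"
proof -
  have "cnj (fourier (indicator B) k) = (\<integral>x. cnj (indicator B x * cis (- (k \<bullet> x))) \<partial>lborel)"
    unfolding fourier_eq_cis by (simp del: complex_cnj_mult)
  also have "\<dots> = (\<integral>x. indicator B x * cis (- ((- k) \<bullet> x)) \<partial>lborel)"
    by (intro Bochner_Integration.integral_cong) (auto simp: cis_cnj indicator_def)
  finally show ?thesis
    by (simp add: fourier_eq_cis)
qed

lemma integral_translate_lborel:
  fixes f :: "'b::euclidean_space \<Rightarrow> 'c::{banach, second_countable_topology}"
  assumes "f \<in> borel_measurable borel"
  shows "(\<integral>x. f (c + x) \<partial>lborel) = (\<integral>x. f x \<partial>lborel)"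
  using assms by (subst (2) lborel_distr_plus[symmetric, of c]) (simp add: integral_distr)

text \<open>The transform of an autocorrelation is a squared modulus, by Fubini. The translation by
  \<open>t\<close> shows up only as a phase of modulus 1, which is why the lattice bound will be
  uniform in \<open>t\<close>.\<close>

lemma fourier_overlap:
  fixes B :: "(real ^ 'n) set"
  assumes B [measurable]: "B \<in> sets borel" and bd: "bounded B"
  shows "has_bochner_integral lborel (\<lambda>s. overlap B (s + t) * cis (k \<bullet> s)) (cis (- (k \<bullet> t)) * (norm (fourier (indicator B) k))\<^sup>2)"
proof -
  define H :: "real ^ 'n \<Rightarrow> real ^ 'n \<Rightarrow> complex"
    where "H s x = indicator B x * indicator B (x + s + t) * cis (k \<bullet> s)" for s x
  have int: "integrable (lborel \<Otimes>\<^sub>M lborel) (\<lambda>(s, x). H s x)"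
  proof -
    \<comment> \<open>\<open>?E\<close> is the support of \<open>H\<close>. It is bounded because
      its first component is a difference of two points of \<open>B\<close>, minus \<open>t\<close>;
      this yields the integrability that Fubini requires.\<close>
    let ?E = "{p :: (real ^ 'n) \<times> (real ^ 'n). snd p \<in> B \<and> snd p + fst p + t \<in> B}"
    have [measurable]: "?E \<in> sets borel"
    proof -
      have [measurable]: "(\<lambda>p :: (real ^ 'n) \<times> (real ^ 'n). snd p + fst p + t) \<in> borel_measurable borel"
          "(snd :: (real ^ 'n) \<times> (real ^ 'n) \<Rightarrow> real ^ 'n) \<in> borel_measurable borel"
        by (intro borel_measurable_continuous_onI continuous_intros)+
      show ?thesis
        by measurable
    qed
    obtain b where b: "\<And>x. x \<in> B \<Longrightarrow> norm x \<le> b"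
      using bd by (auto simp: bounded_iff)
    have "norm p \<le> (b + b + norm t) + b" if "p \<in> ?E" for p
    proof -
      have "fst p = (snd p + fst p + t) - snd p - t"
        by simp
      then have "norm (fst p) \<le> norm (snd p + fst p + t) + norm (snd p) + norm t"
        using norm_triangle_ineq4[of "snd p + fst p + t - snd p" t] norm_triangle_ineq4[of "snd p + fst p + t" "snd p"]
        by simp
      moreover have "norm p \<le> norm (fst p) + norm (snd p)"
        using norm_Pair_le[of "fst p" "snd p"] by simp
      ultimately show ?thesis
        using that b[of "snd p"] b[of "snd p + fst p + t"] by auto
    qed
    then have "bounded ?E"
      unfolding bounded_iff by blast
    then have "integrable lborel (indicator ?E :: _ \<Rightarrow> real)"
      by (intro integrable_indicator_bounded) auto
    then have "integrable (lborel \<Otimes>\<^sub>M lborel) (indicator ?E :: _ \<Rightarrow> real)"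
      by (simp add: lborel_prod)
    then show ?thesis
    proof (rule Bochner_Integration.integrable_bound)
      show "(\<lambda>(s, x). H s x) \<in> borel_measurable (lborel \<Otimes>\<^sub>M lborel)"
        unfolding H_def cis_conv_exp by measurable
      show "AE p in lborel \<Otimes>\<^sub>M lborel. norm (case p of (s, x) \<Rightarrow> H s x) \<le> norm (indicator ?E p :: real)"
        by (auto simp: H_def norm_mult indicator_def)
    qed
  qed
  have inner_x: "(\<integral>x. H s x \<partial>lborel) = overlap B (s + t) * cis (k \<bullet> s)" for s
  proof -
    have "(\<integral>x. H s x \<partial>lborel) = (\<integral>x. of_real (indicator B x * indicator B (x + (s + t))) * cis (k \<bullet> s) \<partial>lborel)"
      by (intro Bochner_Integration.integral_cong) (auto simp: H_def indicator_def add_ac)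
    also have "\<dots> = overlap B (s + t) * cis (k \<bullet> s)"
      by (simp only: integral_mult_left_zero integral_complex_of_real overlap_eq_integral[OF B])
    finally show ?thesis .
  qed
  have inner_s: "(\<integral>s. H s x \<partial>lborel)
      = indicator B x * cis (- (k \<bullet> x)) * (cis (- (k \<bullet> t)) * fourier (indicator B) (- k))" for x
  proof -
    have "(\<lambda>s. H s x) \<in> borel_measurable borel"
      unfolding H_def cis_conv_exp by measurable
    \<comment> \<open>The substitution places the second point \<open>x + s + t\<close> at
      \<open>s\<close>, which separates the variables.\<close>
    then have "(\<integral>s. H s x \<partial>lborel) = (\<integral>s. H (- (x + t) + s) x \<partial>lborel)"
      by (rule integral_translate_lborel[symmetric])
    also have "\<dots> = (\<integral>s. (indicator B x * cis (- (k \<bullet> x)) * cis (- (k \<bullet> t))) * (indicator B s * cis (- ((- k) \<bullet> s))) \<partial>lborel)"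
    proof (intro Bochner_Integration.integral_cong refl)
      fix s
      have "x + (- (x + t) + s) + t = s"
        by simp
      moreover have "cis (k \<bullet> (- (x + t) + s)) = cis (- (k \<bullet> x)) * cis (- (k \<bullet> t)) * cis (- ((- k) \<bullet> s))"
        unfolding cis_mult by (rule arg_cong[where f = cis]) (simp add: inner_diff_right inner_add_right)
      ultimately show "H (- (x + t) + s) x
          = (indicator B x * cis (- (k \<bullet> x)) * cis (- (k \<bullet> t))) * (indicator B s * cis (- ((- k) \<bullet> s)))"
        unfolding H_def by (simp only: mult_ac)
    qed
    also have "\<dots> = indicator B x * cis (- (k \<bullet> x)) * (cis (- (k \<bullet> t)) * fourier (indicator B) (- k))"
      unfolding integral_mult_right_zero fourier_eq_cis by (simp only: mult_ac)
    finally show ?thesis .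
  qed
  have "(\<integral>s. (\<integral>x. H s x \<partial>lborel) \<partial>lborel) = (\<integral>x. (\<integral>s. H s x \<partial>lborel) \<partial>lborel)"
    by (rule lborel_pair.Fubini_integral[OF int, symmetric])
  also have "\<dots> = fourier (indicator B) k * (cis (- (k \<bullet> t)) * fourier (indicator B) (- k))"
    by (simp only: inner_s integral_mult_left_zero fourier_eq_cis[of B k])
  also have "\<dots> = cis (- (k \<bullet> t)) * (norm (fourier (indicator B) k))\<^sup>2"
    unfolding fourier_minus complex_norm_square by simp
  finally show ?thesis
    using lborel_pair.integrable_fst'[OF int] by (simp add: has_bochner_integral_iff inner_x)
qed

text \<open>For fixed \<open>a\<close> the frequencies \<open>v a b\<close> are distinct, so the sum
  of squared coefficients over \<open>b\<close> is part of the full series. The normalisation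
  \<open>N ^ CARD('n)\<close> equals the number of choices of \<open>a\<close>, so an average of
  such partial sums is at most the series itself; the phases drop out in absolute values.\<close>

lemma fejer_overlap:
  fixes B :: "(real ^ 'n) set"
  assumes B: "B \<in> sets borel" "bounded B" and "0 < N"
    and sum: "(\<lambda>k. (norm (fourier (indicator B) ((2 * pi) *\<^sub>R lattice_pt k)))\<^sup>2) summable_on UNIV"
  shows integrable_fejer_overlap: "integrable lborel (\<lambda>s. overlap B (s + t) * fejer_vec N s)"
    and integral_fejer_overlap_le: "(\<integral>s. overlap B (s + t) * fejer_vec N s \<partial>lborel)
      \<le> (\<Sum>\<^sub>\<infinity>k. (norm (fourier (indicator B) ((2 * pi) *\<^sub>R lattice_pt k)))\<^sup>2)"
proof -
  define A where "A = (UNIV :: 'n set) \<rightarrow>\<^sub>E {..<N}"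
  define v :: "('n \<Rightarrow> nat) \<Rightarrow> ('n \<Rightarrow> nat) \<Rightarrow> int ^ 'n" where "v a b = (\<chi> j. int (a j) - int (b j))" for a b
  define w :: "int ^ 'n \<Rightarrow> real ^ 'n" where "w k = (2 * pi) *\<^sub>R lattice_pt k" for k
  define S where "S = (\<Sum>\<^sub>\<infinity>k. (norm (fourier (indicator B) (w k)))\<^sup>2)"
  define I where "I = (\<Sum>a\<in>A. \<Sum>b\<in>A. cis (- (w (v a b) \<bullet> t)) * (norm (fourier (indicator B) (w (v a b))))\<^sup>2)
      / complex_of_real (real N ^ CARD('n))"
  have "has_bochner_integral lborel
      (\<lambda>s. (\<Sum>a\<in>A. \<Sum>b\<in>A. overlap B (s + t) * cis (w (v a b) \<bullet> s)) / complex_of_real (real N ^ CARD('n))) I"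
    unfolding I_def by (intro has_bochner_integral_divide_zero has_bochner_integral_sum fourier_overlap B)
  moreover have "(\<Sum>a\<in>A. \<Sum>b\<in>A. overlap B (s + t) * cis (w (v a b) \<bullet> s)) / complex_of_real (real N ^ CARD('n))
      = complex_of_real (overlap B (s + t) * fejer_vec N s)" for s
    unfolding of_real_mult fejer_vec_eq_sum A_def v_def w_def
    by (simp add: sum_distrib_left mult.assoc)
  ultimately have I: "has_bochner_integral lborel (\<lambda>s. complex_of_real (overlap B (s + t) * fejer_vec N s)) I"
    by simp
  then show "integrable lborel (\<lambda>s. overlap B (s + t) * fejer_vec N s)"
    by (simp only: has_bochner_integral_iff complex_of_real_integrable_eq)
  have fin: "finite A"
    unfolding A_def by (intro finite_PiE) auto
  have "(\<Sum>b\<in>A. (norm (fourier (indicator B) (w (v a b))))\<^sup>2) \<le> S" for a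
  proof -
    have "inj_on (v a) A"
      unfolding A_def v_def by (rule inj_onI) (auto simp: vec_eq_iff fun_eq_iff)
    then have "(\<Sum>b\<in>A. (norm (fourier (indicator B) (w (v a b))))\<^sup>2) = (\<Sum>k\<in>v a ` A. (norm (fourier (indicator B) (w k)))\<^sup>2)"
      by (simp add: sum.reindex)
    also have "\<dots> \<le> S"
      unfolding S_def using sum fin by (intro finite_sum_le_infsum) (auto simp: w_def)
    finally show ?thesis .
  qed
  then have "(\<Sum>a\<in>A. \<Sum>b\<in>A. (norm (fourier (indicator B) (w (v a b))))\<^sup>2) \<le> real (card A) * S"
    by (intro sum_bounded_above) auto
  moreover have "card A = N ^ CARD('n)"
    by (simp add: A_def card_PiE)
  moreover have "norm (\<Sum>a\<in>A. \<Sum>b\<in>A. cis (- (w (v a b) \<bullet> t)) * complex_of_real ((norm (fourier (indicator B) (w (v a b))))\<^sup>2))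
      \<le> (\<Sum>a\<in>A. \<Sum>b\<in>A. (norm (fourier (indicator B) (w (v a b))))\<^sup>2)"
    by (intro sum_norm_le) (simp add: norm_mult norm_power)
  ultimately have "norm I \<le> S"
    using \<open>0 < N\<close> unfolding I_def norm_divide by (simp add: pos_divide_le_eq norm_power mult.commute)
  moreover have "complex_of_real (\<integral>s. overlap B (s + t) * fejer_vec N s \<partial>lborel) = I"
    using I by (simp only: has_bochner_integral_iff integral_complex_of_real)
  then have "\<bar>\<integral>s. overlap B (s + t) * fejer_vec N s \<partial>lborel\<bar> = norm I"
    by (metis norm_of_real)
  ultimately show "(\<integral>s. overlap B (s + t) * fejer_vec N s \<partial>lborel)
      \<le> (\<Sum>\<^sub>\<infinity>k. (norm (fourier (indicator B) ((2 * pi) *\<^sub>R lattice_pt k)))\<^sup>2)"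
    unfolding S_def w_def by linarith
qed

section \<open>Localising the kernel at the lattice points\<close>

lemma integrable_translate_lborel:
  fixes f :: "'b::euclidean_space \<Rightarrow> 'c::{banach, second_countable_topology}"
  assumes "integrable lborel f"
  shows "integrable lborel (\<lambda>x. f (c + x))"
proof -
  have "integrable (distr lborel borel ((+) c)) f"
    using assms by (simp add: lborel_distr_plus)
  then show ?thesis
    by (subst (asm) integrable_distr_eq) (use assms in auto)
qed

lemma norm_centred_box:
  fixes \<delta> :: real
  assumes "s \<in> centred_box \<delta>"
  shows "norm (s :: real ^ 'n) \<le> CARD('n) * \<delta>"
proof -
  have "norm s \<le> (\<Sum>j\<in>UNIV. \<bar>s $ j\<bar>)"
    by (rule norm_le_l1_cart)
  also have "\<dots> \<le> CARD('n) * \<delta>"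
    using assms by (intro sum_bounded_above) (force simp: centred_box_def abs_le_iff minus_le_iff)
  finally show ?thesis .
qed

text \<open>If boxes around two lattice points share a point, their integer coordinates differ by
  less than 1 and so agree.\<close>

lemma sum_indicator_centred_box_le:
  assumes "finite Y" "\<delta> < 1/2"
  shows "(\<Sum>y\<in>Y. indicator (centred_box \<delta>) (s - lattice_pt y)) \<le> (1 :: real)"
proof -
  have "y = z" if "s - lattice_pt y \<in> centred_box \<delta>" "s - lattice_pt z \<in> centred_box \<delta>" for y z
  proof -
    have "y $ j = z $ j" for j
    proof -
      have "s $ j - real_of_int (y $ j) \<in> {-\<delta>..\<delta>}" "s $ j - real_of_int (z $ j) \<in> {-\<delta>..\<delta>}"
        using that by (auto simp: centred_box_def lattice_pt_def)
      then have "real_of_int (y $ j) < real_of_int (z $ j + 1)" "real_of_int (z $ j) < real_of_int (y $ j + 1)"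
        using \<open>\<delta> < 1/2\<close> by auto
      then show ?thesis
        unfolding of_int_less_iff by simp
    qed
    then show ?thesis
      by (simp add: vec_eq_iff)
  qed
  then have "card {y \<in> Y. s - lattice_pt y \<in> centred_box \<delta>} \<le> 1"
    using \<open>finite Y\<close> by (simp add: card_le_Suc0_iff_eq)
  moreover have "(\<Sum>y\<in>Y. indicator (centred_box \<delta>) (s - lattice_pt y)) = real (card {y \<in> Y. s - lattice_pt y \<in> centred_box \<delta>})"
    using \<open>finite Y\<close> by (simp add: indicator_def sum.If_cases Int_def)
  ultimately show ?thesis by simp
qed

text \<open>By periodicity the kernel has the same peak at every lattice point. The boxes around
  these points are disjoint and the integrand is nonnegative, so the contributions of the peaks add
  up to at most the full integral.\<close>

lemma sum_overlap_mult_fejer_mass_le: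
  fixes B :: "(real ^ 'n) set"
  assumes B: "B \<in> sets borel" "bounded B" and "0 < N" "finite Y" "\<delta> < 1/2"
    and sum: "(\<lambda>k. (norm (fourier (indicator B) ((2 * pi) *\<^sub>R lattice_pt k)))\<^sup>2) summable_on UNIV"
    and c: "\<And>v. v \<in> centred_box \<delta> \<Longrightarrow> c \<le> (\<Sum>y\<in>Y. overlap B (lattice_pt y + t + v))"
  shows "c * fejer_mass N \<delta> ^ CARD('n) \<le> (\<Sum>\<^sub>\<infinity>k. (norm (fourier (indicator B) ((2 * pi) *\<^sub>R lattice_pt k)))\<^sup>2)"
proof -
  define g where "g s = overlap B (s + t) * fejer_vec N s" for s
  define f where "f y s = g s * indicator (centred_box \<delta>) (s - lattice_pt y)" for y s
  have int_g: "integrable lborel g"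
    unfolding g_def by (rule integrable_fejer_overlap[OF B \<open>0 < N\<close> sum])
  have g_nonneg: "0 \<le> g s" for s
    by (simp add: g_def overlap_nonneg fejer_vec_nonneg)
  have int_f: "integrable lborel (f y)" for y
    unfolding f_def
  proof (rule Bochner_Integration.integrable_bound[OF int_g])
    show "(\<lambda>s. g s * indicator (centred_box \<delta>) (s - lattice_pt y)) \<in> borel_measurable lborel"
      using int_g by measurable
  qed (simp add: indicator_def)
  have shift: "f y (lattice_pt y + v) = overlap B (lattice_pt y + t + v) * (indicator (centred_box \<delta>) v * fejer_vec N v)" for y v
    unfolding f_def g_def fejer_vec_periodic by (simp add: add_ac)
  have "c * fejer_mass N \<delta> ^ CARD('n) = (\<integral>v. c * (indicator (centred_box \<delta>) v * fejer_vec N v) \<partial>(lborel :: (real ^ 'n) measure))"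
    using has_bochner_integral_fejer_vec[of \<delta> N, where 'n = 'n] by (simp add: has_bochner_integral_iff)
  also have "\<dots> \<le> (\<integral>v. (\<Sum>y\<in>Y. f y (lattice_pt y + v)) \<partial>lborel)"
  proof (rule integral_mono)
    show "integrable lborel (\<lambda>v :: real ^ 'n. c * (indicator (centred_box \<delta>) v * fejer_vec N v))"
      using has_bochner_integral_fejer_vec[of \<delta> N, where 'n = 'n] by (simp add: has_bochner_integral_iff)
    show "integrable lborel (\<lambda>v. \<Sum>y\<in>Y. f y (lattice_pt y + v))"
      by (intro Bochner_Integration.integrable_sum integrable_translate_lborel int_f)
    show "c * (indicator (centred_box \<delta>) v * fejer_vec N v) \<le> (\<Sum>y\<in>Y. f y (lattice_pt y + v))" for v
      unfolding shift sum_distrib_right[symmetric] using c[of v] fejer_vec_nonneg[of N v]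
      by (cases "v \<in> centred_box \<delta>") (auto intro: mult_right_mono)
  qed
  also have "\<dots> = (\<Sum>y\<in>Y. \<integral>v. f y (lattice_pt y + v) \<partial>lborel)"
    by (intro Bochner_Integration.integral_sum integrable_translate_lborel int_f)
  also have "\<dots> = (\<Sum>y\<in>Y. \<integral>s. f y s \<partial>lborel)"
    using borel_measurable_integrable[OF int_f] by (intro sum.cong integral_translate_lborel) auto
  also have "\<dots> = (\<integral>s. (\<Sum>y\<in>Y. f y s) \<partial>lborel)"
    by (rule Bochner_Integration.integral_sum[symmetric]) (rule int_f)
  also have "\<dots> \<le> (\<integral>s. g s \<partial>lborel)"
  proof (rule integral_mono)
    show "(\<Sum>y\<in>Y. f y s) \<le> g s" for s
      using mult_left_mono[OF sum_indicator_centred_box_le[OF \<open>finite Y\<close> \<open>\<delta> < 1/2\<close>, of s] g_nonneg[of s]]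
      by (simp add: f_def sum_distrib_left)
  qed (intro Bochner_Integration.integrable_sum int_f int_g)+
  also have "\<dots> \<le> (\<Sum>\<^sub>\<infinity>k. (norm (fourier (indicator B) ((2 * pi) *\<^sub>R lattice_pt k)))\<^sup>2)"
    unfolding g_def by (rule integral_fejer_overlap_le[OF B \<open>0 < N\<close> sum])
  finally show ?thesis .
qed

text \<open>Near 0 the finite sum \<open>?H\<close> stays above \<open>?L - e\<close> by continuity,
  and as \<open>N\<close> grows the box carries almost all of the mass of the kernel. A finite
  \<open>Y\<close> keeps \<open>?H\<close> continuous, and finite partial sums suffice for the
  series.\<close>

lemma sum_overlap_le_fourier:
  fixes B :: "(real ^ 'n) set"
  assumes B: "B \<in> sets borel" "bounded B" "convex B" and "finite Y"
    and sum: "(\<lambda>k. (norm (fourier (indicator B) ((2 * pi) *\<^sub>R lattice_pt k)))\<^sup>2) summable_on UNIV"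
  shows "(\<Sum>y\<in>Y. overlap B (lattice_pt y + t))
    \<le> (\<Sum>\<^sub>\<infinity>k. (norm (fourier (indicator B) ((2 * pi) *\<^sub>R lattice_pt k)))\<^sup>2)" (is "?L \<le> ?S")
proof (rule field_le_epsilon)
  fix e :: real assume "0 < e"
  let ?H = "\<lambda>v. \<Sum>y\<in>Y. overlap B (lattice_pt y + t + v)"
  have "isCont ?H 0"
  proof (rule continuous_sum)
    fix y
    have "isCont (\<lambda>v. lattice_pt y + t + v) 0"
      by (intro continuous_intros)
    from isCont_o2[OF this isCont_overlap[OF B]]
    show "isCont (\<lambda>v. overlap B (lattice_pt y + t + v)) 0" .
  qed
  then obtain \<eta> where "0 < \<eta>" and \<eta>: "\<And>v. norm v < \<eta> \<Longrightarrow> \<bar>?H v - ?H 0\<bar> < e"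
    using \<open>0 < e\<close> unfolding continuous_at_eps_delta dist_real_def by (metis dist_0_norm dist_commute)
  \<comment> \<open>The value 1/4 keeps boxes around different lattice points disjoint; the other
    term keeps the box inside the ball of radius \<open>\<eta>\<close>, as its points have norm at
    most \<open>CARD('n) * \<delta>\<close>.\<close>
  define \<delta> where "\<delta> = min (1/4) (\<eta> / (2 * CARD('n)))"
  have \<delta>: "0 < \<delta>" "\<delta> < 1/2" "CARD('n) * \<delta> < \<eta>"
  proof -
    have "CARD('n) * \<delta> \<le> CARD('n) * (\<eta> / (2 * CARD('n)))"
      unfolding \<delta>_def by (intro mult_left_mono) auto
    also have "\<dots> < \<eta>"
      using \<open>0 < \<eta>\<close> by simp
    finally show "CARD('n) * \<delta> < \<eta>" .
  qed (use \<open>0 < \<eta>\<close> in \<open>auto simp: \<delta>_def\<close>)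
  have lower: "?L - e \<le> ?H v" if "v \<in> centred_box \<delta>" for v
    using \<eta>[of v] norm_centred_box[OF that] \<delta>(3) by force
  define q where "q = (sin (pi * \<delta>))\<^sup>2"
  have "(\<lambda>N. (?L - e) * (1 - 1 / real N * (1 / q)) ^ CARD('n)) \<longlonglongrightarrow> (?L - e) * (1 - 0 * (1 / q)) ^ CARD('n)"
    by (intro tendsto_intros lim_1_over_n)
  then have lim: "(\<lambda>N. (?L - e) * (1 - 1 / (real N * q)) ^ CARD('n)) \<longlonglongrightarrow> ?L - e"
    by simp
  show "?L \<le> ?S + e"
  \<comment> \<open>Replacing the kernel mass by its lower bound keeps the inequality when the
    factor \<open>?L - e\<close> is nonnegative; in the remaining case \<open>0 \<le> ?S\<close> is
    enough.\<close>
  proof (cases "?L - e \<le> 0")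
    case True
    moreover have "0 \<le> ?S"
      by (intro infsum_nonneg) simp
    ultimately show ?thesis by linarith
  next
    case False
    have "\<forall>\<^sub>F N in sequentially. (?L - e) * (1 - 1 / (real N * q)) ^ CARD('n) \<le> ?S"
    proof -
      have "(\<lambda>N. 1 - 1 / real N * (1 / q)) \<longlonglongrightarrow> 1 - 0 * (1 / q)"
        by (intro tendsto_intros lim_1_over_n)
      then have "\<forall>\<^sub>F N in sequentially. 0 < 1 - 1 / real N * (1 / q)"
        by (rule order_tendstoD) simp
      then show ?thesis
        using eventually_gt_at_top[of 0]
      proof eventually_elim
        fix N :: nat assume pos: "0 < 1 - 1 / real N * (1 / q)" and "0 < N"
        have "(1 - 1 / (real N * q)) ^ CARD('n) \<le> fejer_mass N \<delta> ^ CARD('n)"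
          using pos fejer_mass_ge[OF \<delta>(1,2) \<open>0 < N\<close>] by (intro power_mono) (auto simp: q_def)
        then have "(?L - e) * (1 - 1 / (real N * q)) ^ CARD('n) \<le> (?L - e) * fejer_mass N \<delta> ^ CARD('n)"
          using False by (intro mult_left_mono) auto
        also have "\<dots> \<le> ?S"
          by (rule sum_overlap_mult_fejer_mass_le[OF B(1,2) \<open>0 < N\<close> \<open>finite Y\<close> \<delta>(2) sum lower])
        finally show "(?L - e) * (1 - 1 / (real N * q)) ^ CARD('n) \<le> ?S" .
      qed
    qed
    then have "?L - e \<le> ?S"
      by (rule tendsto_upperbound[OF lim]) simp
    then show ?thesis by simp
  qed
qed

section \<open>Summability and Fourier smoothness\<close>

text \<open>A real supremum dominates its members once the family is bounded above; here 2 is a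
  bound, since each of the two integrals lies in [-1,1].\<close>

lemma norm_diff_upper:
  fixes \<mu> \<nu> :: "'b measure"
  assumes "prob_space \<mu>" "prob_space \<nu>"
    and f: "f \<in> borel_measurable \<mu>" "\<And>x. f x \<in> {-1..1}"
  shows "\<bar>(\<integral>x. f x \<partial>\<mu>) - (\<integral>x. f x \<partial>\<nu>)\<bar> \<le> norm_diff \<mu> \<nu>"
proof -
  have le_1: "\<bar>\<integral>x. g x \<partial>\<rho>\<bar> \<le> 1" if "prob_space \<rho>" "\<And>x. g x \<in> {-1..1}" for \<rho> :: "'b measure" and g :: "'b \<Rightarrow> real"
  \<comment> \<open>If \<open>g\<close> is not integrable, its integral is 0 by convention and the
    bound is trivial.\<close>
  proof (cases "integrable \<rho> g")
    case True
    then have "(\<integral>x. \<bar>g x\<bar> \<partial>\<rho>) \<le> 1"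
      using that(2) by (intro prob_space.integral_le_const that(1)) (auto simp: abs_le_iff minus_le_iff)
    then show ?thesis
      using integral_abs_bound[of \<rho> g] by linarith
  qed (simp add: not_integrable_integral_eq)
  have "\<bar>(\<integral>x. g x \<partial>\<mu>) - (\<integral>x. g x \<partial>\<nu>)\<bar> \<le> 2" if "\<And>x. g x \<in> {-1..1}" for g :: "'b \<Rightarrow> real"
    using le_1[of \<mu> g, OF assms(1) that] le_1[of \<nu> g, OF assms(2) that] by linarith
  then show ?thesis
    unfolding norm_diff_def using f by (intro cSUP_upper bdd_aboveI2[where M = 2]) auto
qed

text \<open>This links unordered sums to integrals over counting measures, which gives access to
  products of series and to dominated convergence.\<close>

lemma summable_on_iff_infsetsum_abs_summable_on:
  fixes f :: "'i \<Rightarrow> real"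
  shows "f summable_on A \<longleftrightarrow> Infinite_Set_Sum.abs_summable_on f A"
  by (rule trans[OF summable_on_iff_abs_summable_on_real abs_summable_equivalent])

lemma summable_on_imp_integrable_count_space:
  fixes f :: "'i \<Rightarrow> real"
  assumes "f summable_on A"
  shows "integrable (count_space A) f" "(\<integral>x. f x \<partial>count_space A) = infsum f A"
proof -
  have "Infinite_Set_Sum.abs_summable_on f A"
    using assms by (rule summable_on_iff_infsetsum_abs_summable_on[THEN iffD1])
  then show "integrable (count_space A) f" "(\<integral>x. f x \<partial>count_space A) = infsum f A"
    using infsetsum_infsum[of f A] by (simp_all add: abs_summable_on_def infsetsum_def)
qed

lemma nn_integral_count_space_infsum:
  fixes f :: "'i \<Rightarrow> real"
  assumes "f summable_on A" "\<And>x. 0 \<le> f x"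
  shows "(\<integral>\<^sup>+x. ennreal (f x) \<partial>count_space A) = ennreal (infsum f A)"
  using summable_on_imp_integrable_count_space[OF assms(1)] assms(2) by (simp add: nn_integral_eq_integral)

lemma summable_on_int_powr:
  assumes "1 < s"
  shows "Infinite_Set_Sum.abs_summable_on (\<lambda>m::int. (1 + \<bar>real_of_int m\<bar>) powr - s) UNIV"
proof -
  let ?f = "\<lambda>m::int. (1 + \<bar>real_of_int m\<bar>) powr - s"
  have "summable (\<lambda>n. real (Suc n) powr - s)"
    using assms by (subst summable_Suc_iff) (simp add: summable_real_powr_iff)
  then have nat: "Infinite_Set_Sum.abs_summable_on (\<lambda>n. (1 + real n) powr - s) UNIV"
    unfolding abs_summable_on_nat_iff' by simp
  have "Infinite_Set_Sum.abs_summable_on ?f (range int \<union> range (\<lambda>n. - int n))"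
    using nat by (intro abs_summable_on_union abs_summable_on_reindex) simp_all
  moreover have "range int \<union> range (\<lambda>n. - int n) = UNIV"
    by (auto simp: image_iff) (metis int_cases2)
  ultimately show ?thesis by simp
qed

text \<open>The norm dominates each coordinate, so the weight is at most a product of
  one-dimensional weights, and the sum is controlled by a product of convergent series over the
  integers.\<close>

lemma summable_on_lattice_powr:
  assumes "0 < \<theta>"
  shows "(\<lambda>k :: int ^ 'n. (1 + norm (lattice_pt k)) powr - (real CARD('n) + \<theta>)) summable_on UNIV"
proof (rule summable_on_comparison_test)
  \<comment> \<open>The exponent is shared equally among the coordinates; since
    \<open>\<theta>\<close> is positive, each share still exceeds 1.\<close>
  define s where "s = 1 + \<theta> / CARD('n)"
  have s: "1 < s" "real CARD('n) * s = real CARD('n) + \<theta>"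
    using assms by (auto simp: s_def field_simps)
  let ?f = "\<lambda>m::int. (1 + \<bar>real_of_int m\<bar>) powr - s"
  have "Infinite_Set_Sum.abs_summable_on (\<lambda>g. \<Prod>j\<in>UNIV. ?f (g j)) (PiE (UNIV :: 'n set) (\<lambda>_. UNIV))"
    by (intro abs_summable_on_prod_PiE summable_on_int_powr s) auto
  then have "Infinite_Set_Sum.abs_summable_on (\<lambda>g :: 'n \<Rightarrow> int. \<Prod>j\<in>UNIV. ?f (g j)) UNIV"
    by simp
  moreover have "bij_betw (\<lambda>k. vec_nth k) (UNIV :: (int ^ 'n) set) UNIV"
    by (rule bij_betw_byWitness[where f' = vec_lambda]) auto
  ultimately have "Infinite_Set_Sum.abs_summable_on (\<lambda>k :: int ^ 'n. \<Prod>j\<in>UNIV. ?f (k $ j)) UNIV"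
    by (subst (asm) abs_summable_on_reindex_bij_betw[symmetric])
  then show "(\<lambda>k :: int ^ 'n. \<Prod>j\<in>UNIV. ?f (k $ j)) summable_on UNIV"
    by (rule summable_on_iff_infsetsum_abs_summable_on[THEN iffD2])
  fix k :: "int ^ 'n"
  have "(1 + norm (lattice_pt k)) powr - (real CARD('n) + \<theta>) = (\<Prod>j\<in>(UNIV :: 'n set). (1 + norm (lattice_pt k)) powr - s)"
  proof -
    have "0 < (1 + norm (lattice_pt k)) powr - s"
      using norm_ge_zero[of "lattice_pt k"] by (simp add: add_nonneg_eq_0_iff)
    moreover have "- (real CARD('n) + \<theta>) = - s * real CARD('n)"
      using s(2) by (simp add: mult.commute)
    ultimately show ?thesis
      by (simp only: powr_powr[symmetric] powr_realpow prod_constant)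
  qed
  also have "\<dots> \<le> (\<Prod>j\<in>UNIV. ?f (k $ j))"
  proof (intro prod_mono conjI powr_mono2')
    show "1 + \<bar>real_of_int (k $ j)\<bar> \<le> 1 + norm (lattice_pt k)" for j
      using component_le_norm_cart[of "lattice_pt k" j] by (simp add: lattice_pt_def)
  qed (use s in auto)
  finally show "(1 + norm (lattice_pt k)) powr - (real CARD('n) + \<theta>) \<le> (\<Prod>j\<in>UNIV. ?f (k $ j))" .
qed simp

section \<open>Fourier coefficients of dilated sets on the dual lattice\<close>

lemma lattice_pt_0 [simp]: "lattice_pt 0 = 0"
  by (simp add: lattice_pt_def vec_eq_iff)

lemma norm_lattice_pt_ge_1:
  assumes "k \<noteq> 0"
  shows "1 \<le> norm (lattice_pt k)"
proof -
  obtain j where "k $ j \<noteq> 0"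
    using assms by (auto simp: vec_eq_iff)
  then have "1 \<le> \<bar>real_of_int (k $ j)\<bar>"
    by simp
  then show ?thesis
    using component_le_norm_cart[of "lattice_pt k" j] by (simp add: lattice_pt_def)
qed

lemma fourier_indicator_0:
  fixes B :: "(real ^ 'n) set"
  assumes "B \<in> sets borel"
  shows "fourier (indicator B) 0 = measure lborel B"
proof -
  have "fourier (indicator B) 0 = (\<integral>x. complex_of_real (indicator B x) \<partial>lborel)"
    unfolding fourier_def by (intro Bochner_Integration.integral_cong) (auto simp: indicator_def)
  then show ?thesis
    using assms by simp
qed

text \<open>Dilation turns a coefficient at k into r^d times one at r k. Squaring, Fourier
  smoothness gives r^(2d) (r |k|)^(-(d + \<theta>)) up to a constant, that is r^(d - \<theta>) times
  a summable weight.\<close>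

lemma fourier_smooth_bound:
  fixes W :: "(real ^ 'n) set"
  assumes "fourier_smooth W"
  obtains C \<theta> where "0 < \<theta>"
    "\<And>r. 1 \<le> r \<Longrightarrow> (\<lambda>k. (norm (fourier (indicator ((*\<^sub>R) r ` W)) ((2 * pi) *\<^sub>R lattice_pt k)))\<^sup>2) summable_on UNIV"
    "\<And>r. 1 \<le> r \<Longrightarrow> (\<Sum>\<^sub>\<infinity>k. (norm (fourier (indicator ((*\<^sub>R) r ` W)) ((2 * pi) *\<^sub>R lattice_pt k)))\<^sup>2)
        \<le> (measure lborel ((*\<^sub>R) r ` W))\<^sup>2 + C * r powr (real CARD('n) - \<theta>)"
proof -
  have [measurable]: "W \<in> sets borel"
    using assms by (simp add: fourier_smooth_def)
  obtain c \<theta> where c: "0 < c" "0 < \<theta>"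
    and bound: "\<And>k. norm (fourier (indicator W) k) \<le> c * (1 + norm k) powr (- (real CARD('n) + \<theta>) / 2)"
    using assms by (auto simp: fourier_smooth_def)
  define \<tau> where "\<tau> k = (1 + norm (lattice_pt k)) powr - (real CARD('n) + \<theta>)" for k :: "int ^ 'n"
  have \<tau>: "\<tau> summable_on UNIV"
    unfolding \<tau>_def using c(2) by (rule summable_on_lattice_powr)
  define f where "f r k = (norm (fourier (indicator ((*\<^sub>R) r ` W)) ((2 * pi) *\<^sub>R lattice_pt k)))\<^sup>2" for r k
  \<comment> \<open>One majorant for all frequencies: the weight \<open>\<tau>\<close> is also
    present at 0, where it is a harmless surplus over the squared volume.\<close>
  define g where "g r k = (if k \<in> {0} then (measure lborel ((*\<^sub>R) r ` W))\<^sup>2 else 0) + c\<^sup>2 * r powr (real CARD('n) - \<theta>) * \<tau> k" for r k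
  have f_le_g: "f r k \<le> g r k" if "1 \<le> r" for r k
  proof (cases "k = 0")
    case True
    have "(*\<^sub>R) r ` W \<in> sets borel"
      using \<open>1 \<le> r\<close> by (intro scaleR_image_borel) auto
    then show ?thesis
      using True by (simp add: f_def g_def fourier_indicator_0 \<tau>_def)
  next
    case False
    let ?x = "1 + norm (r *\<^sub>R (2 * pi) *\<^sub>R lattice_pt k)"
    \<comment> \<open>Nonzero lattice vectors have norm at least 1, so the factor 2 pi in the
      frequency absorbs the summand 1 and a pure power of \<open>r\<close> can be split off.\<close>
    have "r * (1 + norm (lattice_pt k)) \<le> r * (2 * norm (lattice_pt k))"
      using norm_lattice_pt_ge_1[OF False] \<open>1 \<le> r\<close> by (intro mult_left_mono) auto
    also have "\<dots> \<le> r * (2 * pi * norm (lattice_pt k))"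
      using \<open>1 \<le> r\<close> pi_ge_two by (intro mult_left_mono mult_right_mono) auto
    also have "\<dots> \<le> ?x"
      using \<open>1 \<le> r\<close> by simp
    finally have x: "r * (1 + norm (lattice_pt k)) \<le> ?x" .
    have "norm (fourier (indicator ((*\<^sub>R) r ` W)) ((2 * pi) *\<^sub>R lattice_pt k))
        \<le> r ^ CARD('n) * (c * ?x powr (- (real CARD('n) + \<theta>) / 2))"
      using \<open>1 \<le> r\<close> bound[of "r *\<^sub>R (2 * pi) *\<^sub>R lattice_pt k"] by (subst fourier_scaleR_image) auto
    then have "f r k \<le> (r ^ CARD('n) * (c * ?x powr (- (real CARD('n) + \<theta>) / 2)))\<^sup>2"
      unfolding f_def by (intro power_mono) auto
    also have "\<dots> = c\<^sup>2 * (r ^ CARD('n))\<^sup>2 * ?x powr - (real CARD('n) + \<theta>)"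
      by (simp add: power_mult_distrib power2_eq_square[of "_ powr _"] flip: powr_add)
    also have "\<dots> \<le> c\<^sup>2 * (r ^ CARD('n))\<^sup>2 * (r * (1 + norm (lattice_pt k))) powr - (real CARD('n) + \<theta>)"
      using x \<open>1 \<le> r\<close> c(2) by (intro mult_left_mono powr_mono2') (auto intro!: mult_pos_pos add_pos_nonneg)
    also have "\<dots> = c\<^sup>2 * ((r ^ CARD('n))\<^sup>2 * r powr - (real CARD('n) + \<theta>)) * \<tau> k"
      using \<open>1 \<le> r\<close> by (simp add: powr_mult \<tau>_def)
    also have "(r ^ CARD('n))\<^sup>2 * r powr - (real CARD('n) + \<theta>) = r powr (real CARD('n) - \<theta>)"
      using \<open>1 \<le> r\<close> by (simp add: power2_eq_square algebra_simps flip: powr_realpow powr_add)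
    finally show ?thesis
      using False by (simp add: g_def)
  qed
  have "((\<lambda>k. if k \<in> {0} then (measure lborel ((*\<^sub>R) r ` W))\<^sup>2 else 0) has_sum (measure lborel ((*\<^sub>R) r ` W))\<^sup>2) UNIV" for r
    by (rule has_sum_finite_neutralI[of "{0}"]) auto
  then have "(g r has_sum ((measure lborel ((*\<^sub>R) r ` W))\<^sup>2 + c\<^sup>2 * r powr (real CARD('n) - \<theta>) * infsum \<tau> UNIV)) UNIV" for r
    unfolding g_def by (intro has_sum_add has_sum_cmult_right has_sum_infsum \<tau>)
  then have g: "g r summable_on UNIV"
      "infsum (g r) UNIV = (measure lborel ((*\<^sub>R) r ` W))\<^sup>2 + c\<^sup>2 * infsum \<tau> UNIV * r powr (real CARD('n) - \<theta>)" for r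
    by (auto simp: summable_on_def infsumI mult_ac)
  have f: "f r summable_on UNIV" if "1 \<le> r" for r
    by (rule summable_on_comparison_test[OF g(1) f_le_g[OF that]]) (simp add: f_def)
  have "infsum (f r) UNIV \<le> infsum (g r) UNIV" if "1 \<le> r" for r
    by (rule infsum_mono[OF f[OF that] g(1) f_le_g[OF that]])
  with f c(2) show ?thesis
    by (intro that[of \<theta> "c\<^sup>2 * infsum \<tau> UNIV"]) (simp_all add: f_def[abs_def] g)
qed

section \<open>Hyperuniformity\<close>

locale mixing_perturbed_lattice = perturbed_lattice M U Z for M :: "'a measure"
    and U :: "'a \<Rightarrow> real ^ 'n" and Z :: "int ^ 'n \<Rightarrow> 'a \<Rightarrow> real ^ 'n" +
  assumes mixing: "(\<lambda>y. norm_diff (distr M (borel \<Otimes>\<^sub>M borel) (\<lambda>\<omega>. (Z y \<omega>, Z 0 \<omega>)))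
                        (distr M borel (Z 0) \<Otimes>\<^sub>M distr M borel (Z 0))) summable_on UNIV"
begin

section \<open>Comparison with an independent pair of displacements\<close>

definition indep_pair :: "((real ^ 'n) \<times> (real ^ 'n)) measure" where
  "indep_pair = distr M borel (Z 0) \<Otimes>\<^sub>M distr M borel (Z 0)"

definition mixing_coeff :: "int ^ 'n \<Rightarrow> real" where
  "mixing_coeff y = norm_diff (distr M (borel \<Otimes>\<^sub>M borel) (\<lambda>\<omega>. (Z y \<omega>, Z 0 \<omega>))) indep_pair"

definition pair_overlap :: "(real ^ 'n) set \<Rightarrow> int ^ 'n \<Rightarrow> real" where
  "pair_overlap B y = (\<integral>\<omega>. overlap B (lattice_pt y + Z y \<omega> - Z 0 \<omega>) \<partial>M)"

definition indep_overlap :: "(real ^ 'n) set \<Rightarrow> int ^ 'n \<Rightarrow> real" where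
  "indep_overlap B y = (\<integral>p. overlap B (lattice_pt y + fst p - snd p) \<partial>indep_pair)"

lemma mixing_coeff_summable: "mixing_coeff summable_on UNIV"
  using mixing by (simp add: mixing_coeff_def[abs_def] indep_pair_def)

lemma prob_space_indep_pair: "prob_space indep_pair"
proof -
  interpret D: prob_space "distr M borel (Z 0)"
    by (rule prob_space_distr) measurable
  interpret pair_prob_space "distr M borel (Z 0)" "distr M borel (Z 0)" ..
  show ?thesis
    unfolding indep_pair_def by (rule prob_space_axioms)
qed

lemma sets_indep_pair [measurable_cong]: "sets indep_pair = sets (borel \<Otimes>\<^sub>M borel)"
  unfolding indep_pair_def by (intro sets_pair_measure_cong) simp_all

lemma
  assumes B: "B \<in> sets borel" "bounded B" "convex B"
  shows integrable_pair_overlap: "integrable M (\<lambda>\<omega>. overlap B (lattice_pt y + Z y \<omega> - Z 0 \<omega>))"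
    and integrable_indep_overlap: "integrable indep_pair (\<lambda>p. overlap B (lattice_pt y + fst p - snd p))"
proof -
  interpret I: prob_space indep_pair by (rule prob_space_indep_pair)
  note [measurable] = borel_measurable_overlap[OF B]
  show "integrable M (\<lambda>\<omega>. overlap B (lattice_pt y + Z y \<omega> - Z 0 \<omega>))"
    by (rule integrable_const_bound[where B = "measure lborel B"])
       (auto simp: overlap_nonneg overlap_le_measure[OF B(1,2)])
  show "integrable indep_pair (\<lambda>p. overlap B (lattice_pt y + fst p - snd p))"
    by (rule I.integrable_const_bound[where B = "measure lborel B"])
       (auto simp: overlap_nonneg overlap_le_measure[OF B(1,2)])
qed

text \<open>Divided by the volume of \<open>B\<close>, the overlap has values in [0,1] and is an
  admissible test function for \<open>norm_diff\<close>. For a null set both expectations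
  vanish.\<close>

lemma pair_overlap_diff_le:
  assumes B: "B \<in> sets borel" "bounded B" "convex B"
  shows "\<bar>pair_overlap B y - indep_overlap B y\<bar> \<le> measure lborel B * mixing_coeff y"
proof (cases "measure lborel B = 0")
  case True
  then have "overlap B t = 0" for t
    using overlap_le_measure[OF B(1,2), of t] overlap_nonneg[of B t] by simp
  with True show ?thesis
    by (simp add: pair_overlap_def indep_overlap_def)
next
  case False
  let ?Q = "distr M (borel \<Otimes>\<^sub>M borel) (\<lambda>\<omega>. (Z y \<omega>, Z 0 \<omega>))"
  let ?f = "\<lambda>p. overlap B (lattice_pt y + fst p - snd p) / measure lborel B"
  note [measurable] = borel_measurable_overlap[OF B]
  have pos: "0 < measure lborel B"
    using False by (simp add: zero_less_measure_iff)
  have "\<bar>(\<integral>p. ?f p \<partial>?Q) - (\<integral>p. ?f p \<partial>indep_pair)\<bar> \<le> mixing_coeff y"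
    unfolding mixing_coeff_def
  proof (rule norm_diff_upper)
    show "prob_space ?Q"
      by (rule prob_space_distr) measurable
    show "?f p \<in> {-1..1}" for p
      using overlap_le_measure[OF B(1,2)] overlap_nonneg[of B] pos
      by (auto simp: pos_divide_le_eq intro: order_trans[OF _ divide_nonneg_pos])
  qed (simp_all add: prob_space_indep_pair)
  also have "(\<integral>p. ?f p \<partial>?Q) - (\<integral>p. ?f p \<partial>indep_pair) = (pair_overlap B y - indep_overlap B y) / measure lborel B"
    by (simp add: integral_distr pair_overlap_def indep_overlap_def diff_divide_distrib)
  finally show ?thesis
    using pos by (simp add: abs_divide pos_divide_le_eq mult.commute)
qed

lemma pair_overlap_diff_summable:
  assumes B: "B \<in> sets borel" "bounded B" "convex B"
  shows "(\<lambda>y. \<bar>pair_overlap B y - indep_overlap B y\<bar>) summable_on UNIV"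
  by (rule summable_on_comparison_test[OF summable_on_cmult_right[OF mixing_coeff_summable] pair_overlap_diff_le[OF B]]) simp

text \<open>Under \<open>indep_pair\<close> the same shift \<open>fst p - snd p\<close> serves every
  \<open>y\<close>, so the bound uniform in the shift holds inside the integral and survives
  averaging.\<close>

lemma indep_overlap_sum:
  fixes B :: "(real ^ 'n) set"
  defines "S \<equiv> (\<Sum>\<^sub>\<infinity>k. (norm (fourier (indicator B) ((2 * pi) *\<^sub>R lattice_pt k)))\<^sup>2)"
  assumes B: "B \<in> sets borel" "bounded B" "convex B"
    and sum: "(\<lambda>k. (norm (fourier (indicator B) ((2 * pi) *\<^sub>R lattice_pt k)))\<^sup>2) summable_on UNIV"
  shows indep_overlap_summable: "indep_overlap B summable_on UNIV"
    and infsum_indep_overlap_le: "infsum (indep_overlap B) UNIV \<le> S"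
proof -
  interpret I: prob_space indep_pair by (rule prob_space_indep_pair)
  have le: "(\<Sum>y\<in>Y. indep_overlap B y) \<le> S" if "finite Y" for Y
  proof -
    have "(\<Sum>y\<in>Y. indep_overlap B y) = (\<integral>p. (\<Sum>y\<in>Y. overlap B (lattice_pt y + fst p - snd p)) \<partial>indep_pair)"
      unfolding indep_overlap_def
      by (rule Bochner_Integration.integral_sum[symmetric]) (rule integrable_indep_overlap[OF B])
    also have "\<dots> \<le> S"
    proof (rule I.integral_le_const)
      show "integrable indep_pair (\<lambda>p. \<Sum>y\<in>Y. overlap B (lattice_pt y + fst p - snd p))"
        by (intro Bochner_Integration.integrable_sum integrable_indep_overlap[OF B])
      show "AE p in indep_pair. (\<Sum>y\<in>Y. overlap B (lattice_pt y + fst p - snd p)) \<le> S"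
        unfolding S_def using sum_overlap_le_fourier[OF B that sum] by (simp add: add_diff_eq[symmetric])
    qed
    finally show ?thesis .
  qed
  show *: "indep_overlap B summable_on UNIV"
    by (rule nonneg_bdd_above_summable_on)
       (auto simp: indep_overlap_def overlap_nonneg intro!: bdd_aboveI2[where M = S] le[unfolded indep_overlap_def])
  show "infsum (indep_overlap B) UNIV \<le> S"
    by (rule infsum_le_finite_sums[OF *]) (rule le)
qed

text \<open>The estimate is carried out with extended integrals, so that finiteness of the second
  moment comes out as a conclusion.\<close>

lemma nn_integral_square_le:
  fixes B :: "(real ^ 'n) set"
  defines "S \<equiv> (\<Sum>\<^sub>\<infinity>k. (norm (fourier (indicator B) ((2 * pi) *\<^sub>R lattice_pt k)))\<^sup>2)"
  assumes B: "B \<in> sets borel" "bounded B" "convex B"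
    and sum: "(\<lambda>k. (norm (fourier (indicator B) ((2 * pi) *\<^sub>R lattice_pt k)))\<^sup>2) summable_on UNIV"
  shows "(\<integral>\<^sup>+\<omega>. (emeasure (lattice_process \<omega>) B)\<^sup>2 \<partial>M)
    \<le> ennreal ((\<Sum>\<^sub>\<infinity>y. \<bar>pair_overlap B y - indep_overlap B y\<bar>) + S)"
proof -
  have nonneg: "0 \<le> indep_overlap B y" for y
    by (simp add: indep_overlap_def overlap_nonneg)
  have "(\<integral>\<^sup>+\<omega>. (emeasure (lattice_process \<omega>) B)\<^sup>2 \<partial>M) = (\<integral>\<^sup>+y. ennreal (pair_overlap B y) \<partial>count_space UNIV)"
    unfolding nn_integral_lattice_process_square[OF B(1,2)] pair_overlap_def
    by (intro nn_integral_cong nn_integral_eq_integral integrable_pair_overlap[OF B]) (simp add: overlap_nonneg)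
  also have "\<dots> \<le> (\<integral>\<^sup>+y. ennreal (\<bar>pair_overlap B y - indep_overlap B y\<bar> + indep_overlap B y) \<partial>count_space UNIV)"
    by (intro nn_integral_mono ennreal_leI) simp
  also have "\<dots> = ennreal (\<Sum>\<^sub>\<infinity>y. \<bar>pair_overlap B y - indep_overlap B y\<bar> + indep_overlap B y)"
    using nonneg by (intro nn_integral_count_space_infsum summable_on_add pair_overlap_diff_summable[OF B]
        indep_overlap_summable[OF B sum]) simp
  also have "\<dots> \<le> ennreal ((\<Sum>\<^sub>\<infinity>y. \<bar>pair_overlap B y - indep_overlap B y\<bar>) + S)"
    using infsum_indep_overlap_le[OF B sum]
    by (subst infsum_add[OF pair_overlap_diff_summable[OF B] indep_overlap_summable[OF B sum]])
       (auto simp: S_def intro!: ennreal_leI)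
  finally show ?thesis .
qed

lemma variance_lattice_process_le:
  fixes B :: "(real ^ 'n) set"
  defines "S \<equiv> (\<Sum>\<^sub>\<infinity>k. (norm (fourier (indicator B) ((2 * pi) *\<^sub>R lattice_pt k)))\<^sup>2)"
  assumes B: "B \<in> sets borel" "bounded B" "convex B"
    and sum: "(\<lambda>k. (norm (fourier (indicator B) ((2 * pi) *\<^sub>R lattice_pt k)))\<^sup>2) summable_on UNIV"
  shows "variance (\<lambda>\<omega>. measure (lattice_process \<omega>) B)
    \<le> (\<Sum>\<^sub>\<infinity>y. \<bar>pair_overlap B y - indep_overlap B y\<bar>) + S - (measure lborel B)\<^sup>2"
proof -
  define X where "X \<omega> = measure (lattice_process \<omega>) B" for \<omega>
  have [measurable]: "X \<in> borel_measurable M"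
    unfolding X_def measure_def using B(1) by measurable
  \<comment> \<open>\<open>measure\<close> returns 0 where the count is infinite, so
    \<open>X\<close> represents the count only off the null event excluded here by the finite
    mean.\<close>
  have "AE \<omega> in M. emeasure (lattice_process \<omega>) B \<noteq> \<infinity>"
    using emeasure_bounded_finite[OF B(2)] B(1)
    by (intro nn_integral_PInf_AE) (simp_all add: nn_integral_lattice_process_emeasure)
  then have X: "AE \<omega> in M. emeasure (lattice_process \<omega>) B = ennreal (X \<omega>)"
    by eventually_elim (simp add: X_def emeasure_eq_ennreal_measure)
  have "(\<integral>\<^sup>+\<omega>. ennreal (X \<omega>) \<partial>M) = ennreal (measure lborel B)"
  proof -
    have "(\<integral>\<^sup>+\<omega>. ennreal (X \<omega>) \<partial>M) = (\<integral>\<^sup>+\<omega>. emeasure (lattice_process \<omega>) B \<partial>M)"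
      using X by (intro nn_integral_cong_AE) auto
    then show ?thesis
      using emeasure_bounded_finite[OF B(2)] B(1)
      by (simp add: nn_integral_lattice_process_emeasure emeasure_eq_ennreal_measure)
  qed
  then have 1: "has_bochner_integral M X (measure lborel B)"
    by (intro has_bochner_integral_nn_integral) (auto simp: X_def)
  let ?R = "(\<Sum>\<^sub>\<infinity>y. \<bar>pair_overlap B y - indep_overlap B y\<bar>) + S"
  have "0 \<le> ?R"
    unfolding S_def by (intro add_nonneg_nonneg infsum_nonneg) auto
  have le: "(\<integral>\<^sup>+\<omega>. ennreal ((X \<omega>)\<^sup>2) \<partial>M) \<le> ennreal ?R"
  proof -
    have "(\<integral>\<^sup>+\<omega>. ennreal ((X \<omega>)\<^sup>2) \<partial>M) = (\<integral>\<^sup>+\<omega>. (emeasure (lattice_process \<omega>) B)\<^sup>2 \<partial>M)"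
      using X by (intro nn_integral_cong_AE) (auto simp: ennreal_power X_def)
    then show ?thesis
      using nn_integral_square_le[OF B sum] by (simp add: S_def)
  qed
  then have int: "integrable M (\<lambda>\<omega>. (X \<omega>)\<^sup>2)"
    by (intro integrableI_bounded) (auto intro: le_less_trans)
  then have "ennreal (\<integral>\<omega>. (X \<omega>)\<^sup>2 \<partial>M) \<le> ennreal ?R"
    using le by (subst (asm) nn_integral_eq_integral) auto
  then have "(\<integral>\<omega>. (X \<omega>)\<^sup>2 \<partial>M) \<le> ?R"
    using \<open>0 \<le> ?R\<close> by simp
  moreover have "variance X = (\<integral>\<omega>. (X \<omega>)\<^sup>2 \<partial>M) - (expectation X)\<^sup>2"
    using 1 int by (intro variance_eq) (auto simp: has_bochner_integral_iff)
  ultimately show ?thesis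
    using 1 by (simp add: has_bochner_integral_iff X_def[abs_def])
qed

text \<open>Dominated convergence is used at two levels. For fixed \<open>y\<close> both normalised
  expectations tend to 1, the ratios being at most 1, so their difference vanishes. For the sum over
  \<open>y\<close>, viewed as an integral over the counting measure, \<open>mixing_coeff\<close> is
  a majorant free of \<open>r\<close>.\<close>

lemma tendsto_infsum_overlap_diff:
  fixes W :: "(real ^ 'n) set"
  assumes W: "W \<in> sets borel" "bounded W" "convex W" and "measure lborel W \<noteq> 0"
  shows "((\<lambda>r. (\<Sum>\<^sub>\<infinity>y. \<bar>pair_overlap ((*\<^sub>R) r ` W) y - indep_overlap ((*\<^sub>R) r ` W) y\<bar>)
    / measure lborel ((*\<^sub>R) r ` W)) \<longlongrightarrow> 0) at_top"
proof -
  interpret I: prob_space indep_pair by (rule prob_space_indep_pair)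
  note [measurable] = borel_measurable_overlap[OF W]
  define D where "D r y = \<bar>pair_overlap ((*\<^sub>R) r ` W) y - indep_overlap ((*\<^sub>R) r ` W) y\<bar> / measure lborel ((*\<^sub>R) r ` W)" for r y
  have pos: "0 < measure lborel W"
    using assms(4) by (simp add: zero_less_measure_iff)
  have rW: "(*\<^sub>R) r ` W \<in> sets borel" "bounded ((*\<^sub>R) r ` W)" "convex ((*\<^sub>R) r ` W)" if "0 < r" for r
    using W that by (auto intro: scaleR_image_borel bounded_scaling convex_scaling)
  have m_pos: "0 < measure lborel ((*\<^sub>R) r ` W)" if "0 < r" for r
    using that pos W(1) by (simp add: measure_scaleR_image)
  have ratio: "overlap ((*\<^sub>R) r ` W) t / measure lborel ((*\<^sub>R) r ` W) = overlap W (t /\<^sub>R r) / measure lborel W"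
    if "0 < r" for r t
    using that W(1) by (simp add: measure_scaleR_image overlap_scaleR_image)
  have bound: "norm (overlap W t / measure lborel W) \<le> 1" for t
    using pos overlap_nonneg[of W t] overlap_le_measure[OF W(1,2), of t] by simp
  have "((\<lambda>r. D r y) \<longlongrightarrow> 0) at_top" for y
  proof -
    let ?a = "\<lambda>r. \<integral>\<omega>. overlap W ((lattice_pt y + Z y \<omega> - Z 0 \<omega>) /\<^sub>R r) / measure lborel W \<partial>M"
    let ?b = "\<lambda>r. \<integral>p. overlap W ((lattice_pt y + fst p - snd p) /\<^sub>R r) / measure lborel W \<partial>indep_pair"
    have "(?a \<longlongrightarrow> (\<integral>\<omega>. 1 \<partial>M)) at_top"
      by (rule integral_dominated_convergence_at_top[where w = "\<lambda>_. 1"])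
         (use tendsto_overlap_ratio[OF assms] bound in auto)
    moreover have "(?b \<longlongrightarrow> (\<integral>p. 1 \<partial>indep_pair)) at_top"
      by (rule integral_dominated_convergence_at_top[where w = "\<lambda>_. 1"])
         (use tendsto_overlap_ratio[OF assms] bound in auto)
    ultimately have "((\<lambda>r. \<bar>?a r - ?b r\<bar>) \<longlongrightarrow> \<bar>1 - 1\<bar>) at_top"
      by (intro tendsto_rabs tendsto_diff) (simp_all add: prob_space I.prob_space)
    moreover have "\<forall>\<^sub>F r in at_top. \<bar>?a r - ?b r\<bar> = D r y"
      using eventually_gt_at_top[of 0]
    proof eventually_elim
      fix r :: real assume "0 < r"
      then have "?a r = pair_overlap ((*\<^sub>R) r ` W) y / measure lborel ((*\<^sub>R) r ` W)"
          "?b r = indep_overlap ((*\<^sub>R) r ` W) y / measure lborel ((*\<^sub>R) r ` W)"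
        by (simp_all add: pair_overlap_def indep_overlap_def flip: ratio integral_divide_zero)
      then show "\<bar>?a r - ?b r\<bar> = D r y"
        by (simp add: D_def abs_divide flip: diff_divide_distrib)
    qed
    ultimately show ?thesis
      by (auto dest: tendsto_cong[THEN iffD1, rotated])
  qed
  then have "((\<lambda>r. \<integral>y. D r y \<partial>count_space UNIV) \<longlongrightarrow> (\<integral>y. 0 \<partial>count_space (UNIV :: (int ^ 'n) set))) at_top"
  proof (intro integral_dominated_convergence_at_top[where w = mixing_coeff] AE_I2)
    show "integrable (count_space UNIV) mixing_coeff"
      by (rule summable_on_imp_integrable_count_space[OF mixing_coeff_summable])
    show "\<forall>\<^sub>F r in at_top. AE y in count_space UNIV. norm (D r y) \<le> mixing_coeff y"
      using eventually_gt_at_top[of 0]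
    proof eventually_elim
      fix r :: real assume "0 < r"
      then show "AE y in count_space UNIV. norm (D r y) \<le> mixing_coeff y"
        using pair_overlap_diff_le[OF rW[OF \<open>0 < r\<close>]] m_pos[OF \<open>0 < r\<close>]
        by (auto simp: D_def pos_divide_le_eq mult.commute)
    qed
  qed auto
  moreover have "\<forall>\<^sub>F r in at_top. (\<integral>y. D r y \<partial>count_space UNIV)
      = (\<Sum>\<^sub>\<infinity>y. \<bar>pair_overlap ((*\<^sub>R) r ` W) y - indep_overlap ((*\<^sub>R) r ` W) y\<bar>) / measure lborel ((*\<^sub>R) r ` W)"
    using eventually_gt_at_top[of 0]
  proof eventually_elim
    fix r :: real assume "0 < r"
    then show "(\<integral>y. D r y \<partial>count_space UNIV)
      = (\<Sum>\<^sub>\<infinity>y. \<bar>pair_overlap ((*\<^sub>R) r ` W) y - indep_overlap ((*\<^sub>R) r ` W) y\<bar>) / measure lborel ((*\<^sub>R) r ` W)"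
      unfolding D_def integral_divide_zero
      by (simp add: summable_on_imp_integrable_count_space(2)[OF pair_overlap_diff_summable[OF rW]])
  qed
  ultimately show ?thesis
    by (auto dest: tendsto_cong[THEN iffD1, rotated])
qed

text \<open>The moment bound is available for convex sets with summable coefficients only. A general
  bounded \<open>B\<close> is enclosed in a dilate of \<open>W\<close>, which is possible because 0
  is interior to \<open>W\<close>.\<close>

lemma second_moment_finite:
  fixes W B :: "(real ^ 'n) set"
  assumes "W \<in> K0" "fourier_smooth W" and B: "B \<in> sets borel" "bounded B"
  shows "(\<integral>\<^sup>+\<omega>. (emeasure (lattice_process \<omega>) B)\<^sup>2 \<partial>M) < \<infinity>"
proof -
  obtain C \<theta> where sum: "\<And>r. 1 \<le> r \<Longrightarrow> (\<lambda>k. (norm (fourier (indicator ((*\<^sub>R) r ` W)) ((2 * pi) *\<^sub>R lattice_pt k)))\<^sup>2) summable_on UNIV"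
    using fourier_smooth_bound[OF assms(2)] by metis
  have W: "convex W" "bounded W" "0 \<in> interior W" "W \<in> sets borel"
    using assms by (auto simp: K0_def fourier_smooth_def)
  then obtain e where "0 < e" and e: "ball 0 e \<subseteq> W"
    by (auto simp: mem_interior)
  obtain b where b: "\<And>x. x \<in> B \<Longrightarrow> norm x \<le> b"
    using B(2) by (auto simp: bounded_iff)
  \<comment> \<open>The quotient gives \<open>b < r * e\<close>, so \<open>B\<close> fits into the
    dilated ball inside the dilate of \<open>W\<close>; the value 1 keeps \<open>r\<close> in the
    range of the Fourier estimate.\<close>
  define r where "r = max 1 ((b + 1) / e)"
  have r: "1 \<le> r" "b < r * e"
    using \<open>0 < e\<close> by (auto simp: r_def max_def field_simps)
  have "B \<subseteq> (*\<^sub>R) r ` W"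
  proof
    fix x assume "x \<in> B"
    then have "norm (x /\<^sub>R r) < e"
      using b[of x] r by (simp add: divide_inverse[symmetric] pos_divide_less_eq mult.commute[of _ r] inverse_eq_divide)
    then have "x /\<^sub>R r \<in> W"
      using e by auto
    then show "x \<in> (*\<^sub>R) r ` W"
      using r(1) by (intro image_eqI[of _ _ "x /\<^sub>R r"]) auto
  qed
  moreover have rW: "(*\<^sub>R) r ` W \<in> sets borel" "bounded ((*\<^sub>R) r ` W)" "convex ((*\<^sub>R) r ` W)"
    using W r(1) by (auto intro!: scaleR_image_borel bounded_scaling convex_scaling)
  ultimately have "(\<integral>\<^sup>+\<omega>. (emeasure (lattice_process \<omega>) B)\<^sup>2 \<partial>M) \<le> (\<integral>\<^sup>+\<omega>. (emeasure (lattice_process \<omega>) ((*\<^sub>R) r ` W))\<^sup>2 \<partial>M)"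
    by (intro nn_integral_mono power_mono emeasure_mono) (auto simp: lattice_process_def)
  also have "\<dots> < \<infinity>"
    by (rule le_less_trans[OF nn_integral_square_le[OF rW sum[OF r(1)]]]) simp
  finally show ?thesis .
qed

text \<open>The squared volume in the Fourier bound cancels the squared mean. After division by the
  volume, of order r^d, the comparison error tends to 0 and the nonzero frequencies leave a multiple
  of \<open>r powr - \<theta>\<close>.\<close>

lemma hyperuniform_lattice_process:
  fixes W :: "(real ^ 'n) set"
  assumes "W \<in> K0" "fourier_smooth W"
  shows "hyperuniform M lattice_process W"
  unfolding hyperuniform_def
proof (intro conjI ballI impI second_moment_finite[OF assms])
  obtain C \<theta> where "0 < \<theta>"
    and sum: "\<And>r. 1 \<le> r \<Longrightarrow> (\<lambda>k. (norm (fourier (indicator ((*\<^sub>R) r ` W)) ((2 * pi) *\<^sub>R lattice_pt k)))\<^sup>2) summable_on UNIV"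
    and le: "\<And>r. 1 \<le> r \<Longrightarrow> (\<Sum>\<^sub>\<infinity>k. (norm (fourier (indicator ((*\<^sub>R) r ` W)) ((2 * pi) *\<^sub>R lattice_pt k)))\<^sup>2)
        \<le> (measure lborel ((*\<^sub>R) r ` W))\<^sup>2 + C * r powr (real CARD('n) - \<theta>)"
    using fourier_smooth_bound[OF assms(2)] by metis
  have W: "W \<in> sets borel" "bounded W" "convex W" "0 \<in> interior W"
    using assms by (auto simp: K0_def fourier_smooth_def)
  have pos: "0 < measure lborel W"
  proof -
    obtain e where "0 < e" "ball 0 e \<subseteq> W"
      using W(4) by (auto simp: mem_interior)
    then have "measure lborel (ball (0 :: real ^ 'n) e) \<le> measure lborel W"
      using W(1) emeasure_bounded_finite[OF W(2)] by (intro measure_mono_fmeasurable fmeasurableI) auto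
    moreover have "0 < measure lborel (ball (0 :: real ^ 'n) e)"
      using \<open>0 < e\<close> content_ball_pos[of e "0 :: real ^ 'n"] by simp
    ultimately show ?thesis by linarith
  qed
  let ?V = "\<lambda>r. variance (\<lambda>\<omega>. measure (lattice_process \<omega>) ((*\<^sub>R) r ` W)) / measure lborel ((*\<^sub>R) r ` W)"
  let ?D = "\<lambda>r. (\<Sum>\<^sub>\<infinity>y. \<bar>pair_overlap ((*\<^sub>R) r ` W) y - indep_overlap ((*\<^sub>R) r ` W) y\<bar>) / measure lborel ((*\<^sub>R) r ` W)"
  have "((\<lambda>r. ?D r + C / measure lborel W * r powr - \<theta>) \<longlongrightarrow> 0 + C / measure lborel W * 0) at_top"
    using \<open>0 < \<theta>\<close> pos by (intro tendsto_add tendsto_mult tendsto_const tendsto_infsum_overlap_diff W(1-3) tendsto_neg_powr filterlim_ident) auto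
  then have lim: "((\<lambda>r. ?D r + C / measure lborel W * r powr - \<theta>) \<longlongrightarrow> 0) at_top"
    by simp
  have "\<forall>\<^sub>F r in at_top. ?V r \<le> ?D r + C / measure lborel W * r powr - \<theta>"
    using eventually_ge_at_top[of 1]
  proof eventually_elim
    fix r :: real assume r: "1 \<le> r"
    let ?m = "measure lborel ((*\<^sub>R) r ` W)"
    have rW: "(*\<^sub>R) r ` W \<in> sets borel" "bounded ((*\<^sub>R) r ` W)" "convex ((*\<^sub>R) r ` W)"
      using W r by (auto intro!: scaleR_image_borel bounded_scaling convex_scaling)
    have m: "?m = r ^ CARD('n) * measure lborel W"
      using r W(1) by (subst measure_scaleR_image) auto
    have "variance (\<lambda>\<omega>. measure (lattice_process \<omega>) ((*\<^sub>R) r ` W))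
        \<le> (\<Sum>\<^sub>\<infinity>y. \<bar>pair_overlap ((*\<^sub>R) r ` W) y - indep_overlap ((*\<^sub>R) r ` W) y\<bar>) + C * r powr (real CARD('n) - \<theta>)"
      using variance_lattice_process_le[OF rW sum[OF r]] le[OF r] by linarith
    then have "?V r \<le> ((\<Sum>\<^sub>\<infinity>y. \<bar>pair_overlap ((*\<^sub>R) r ` W) y - indep_overlap ((*\<^sub>R) r ` W) y\<bar>) + C * r powr (real CARD('n) - \<theta>)) / ?m"
      by (rule divide_right_mono) simp
    also have "\<dots> = ?D r + C * r powr (real CARD('n) - \<theta>) / ?m"
      by (rule add_divide_distrib)
    also have "C * r powr (real CARD('n) - \<theta>) / ?m = C / measure lborel W * r powr - \<theta>"
      using r pos unfolding m by (simp add: powr_diff powr_minus powr_realpow field_simps)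
    finally show "?V r \<le> ?D r + C / measure lborel W * r powr - \<theta>" .
  qed
  moreover have "\<forall>\<^sub>F r in at_top. 0 \<le> ?V r"
    by (intro always_eventually allI divide_nonneg_nonneg variance_positive) simp
  ultimately show "(?V \<longlongrightarrow> 0) at_top"
    using lim by (intro tendsto_sandwich[OF _ _ tendsto_const lim])
qed

end

theorem theorem5p5:
  fixes M :: "'a measure"
    and U :: "'a \<Rightarrow> real ^ 'n"
    and Z :: "int ^ 'n \<Rightarrow> 'a \<Rightarrow> real ^ 'n"
    and \<Gamma> :: "'a \<Rightarrow> (real ^ 'n) measure"
  assumes "prob_space M"
    and "U \<in> borel_measurable M"
    and "distr M borel U = uniform_measure lborel (cbox 0 1)"
    and "\<And>x. Z x \<in> borel_measurable M"
    and "stationary_field M Z"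
    and "indep_elements M borel U (\<Pi>\<^sub>M x\<in>UNIV. borel) (\<lambda>\<omega> x. Z x \<omega>)"
    and "(\<lambda>y. norm_diff (distr M (borel \<Otimes>\<^sub>M borel) (\<lambda>\<omega>. (Z y \<omega>, Z 0 \<omega>)))
                        (distr M borel (Z 0) \<Otimes>\<^sub>M distr M borel (Z 0))) summable_on UNIV"
    and "\<Gamma> = (\<lambda>\<omega>. dirac_sum (\<lambda>x. lattice_pt x + U \<omega> + Z x \<omega>))"
  shows "stationary_point_process M \<Gamma> \<and>
         (\<forall>W \<in> K0. fourier_smooth W \<longrightarrow> hyperuniform M \<Gamma> W)"
proof -
  have "perturbed_lattice M U Z"
    by (rule perturbed_lattice.intro, fact) (rule perturbed_lattice_axioms.intro; fact)
  then interpret mixing_perturbed_lattice M U Z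
    by (rule mixing_perturbed_lattice.intro) (rule mixing_perturbed_lattice_axioms.intro; fact)
  have "\<Gamma> = lattice_process"
    by (simp add: assms(8) lattice_process_def[abs_def])
  then show ?thesis
    using stationary_lattice_process hyperuniform_lattice_process by blast
qed

end
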